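(* $\mathsf{oneway\mbox{-}IP}(\mathrm{cons\mbox{-}space},\mathrm{cons\mbox{-}random\mbox{-}bits},\mathrm{1way\mbox{-}input})=\mathsf{IP}(\mathrm{cons\mbox{-}space},\mathrm{cons\mbox{-}random\mbox{-}bits},\mathrm{1way\mbox{-}input})=\bigcup_{k\ge1}\mathsf{1NFA}(k)$.
   Context: A verifier is a probabilistic Turing machine with a read-only input tape (input between two end-markers), one read/write work tape, private fair random bits, and a communication cell over a finite alphabet containing a null symbol; the prover's reply depends on the input and the full communication history. In a one-way system the prover's messages form a fixed sequence depending only on the input (a certificate read one-way). A (strong) interactive proof system with error $\varepsilon$ for $L$: some prover makes every $x\in L$ accepted with probability $\ge1-\varepsilon$, and for $x\notin L$ every prover leads to rejection with probability $\ge1-\varepsilon$. $\mathsf{IP}(\cdot)$ and $\mathsf{oneway\mbox{-}IP}(\cdot)$ are the classes of languages with such (two-way, resp. one-way communication) systems with some $\varepsilon<\frac12$ whose verifier satisfies: cons-space = $O(1)$ work-tape cells; cons-random-bits = number of coin tosses bounded by a constant independent of the input; 1way-input = the input head never moves left. No time bound is imposed. $\mathsf{1NFA}(k)$ is the class of languages recognized by nondeterministic finite automata with $k$ one-way (never moving left) heads on a read-only tape containing the input between end-markers. *)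

theory Defs
  imports "HOL-Probability.Probability"
begin

section \<open>Input tapes\<close>

datatype 'a tape_symbol = LeftEnd | Sym 'a | RightEnd

text \<open>Positions beyond \<open>length x + 1\<close> are never reached by the machines below.\<close>

definition input_tape :: "'a list \<Rightarrow> nat \<Rightarrow> 'a tape_symbol" where
  "input_tape x i =
     (if i = 0 then LeftEnd else if i \<le> length x then Sym (x ! (i - 1)) else RightEnd)"


section \<open>Verifiers\<close>

datatype direction = GoLeft | Stay | GoRight

text \<open>
  \<open>vdelta V q a w g b = (q', w', g', di, dw)\<close>: in state \<open>q\<close>, scanning \<open>a\<close> on the input tape and
  \<open>w\<close> on the work tape, with \<open>g\<close> in the communication cell, the verifier enters \<open>q'\<close>, writes \<open>w'\<close>
  on the work tape and \<open>g'\<close> into the communication cell, and moves the two heads.  The argument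
  \<open>b\<close> is \<open>Some\<close> of a fresh random bit if \<open>q\<close> is a coin-tossing state, and \<open>None\<close> otherwise.
\<close>

record ('a, 'q, 'w, 'g) verifier =
  vstates :: "'q set"
  vstart :: 'q
  vaccept :: 'q
  vreject :: 'q
  vcoin :: "'q set"
  vwork :: "'w set"
  vblank :: 'w
  vcomm :: "'g set"
  vnull :: 'g
  vdelta :: "'q \<Rightarrow> 'a tape_symbol \<Rightarrow> 'w \<Rightarrow> 'g \<Rightarrow> bool option
               \<Rightarrow> 'q \<times> 'w \<times> 'g \<times> direction \<times> direction"

definition is_verifier :: "('a, 'q, 'w, 'g) verifier \<Rightarrow> bool" where
  "is_verifier V \<longleftrightarrow>
     finite (vstates V) \<and> finite (vwork V) \<and> finite (vcomm V) \<and>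
     vstart V \<in> vstates V \<and> vaccept V \<in> vstates V \<and> vreject V \<in> vstates V \<and>
     vaccept V \<noteq> vreject V \<and> vcoin V \<subseteq> vstates V \<and>
     vblank V \<in> vwork V \<and> vnull V \<in> vcomm V \<and>
     (\<forall>q\<in>vstates V. \<forall>a. \<forall>w\<in>vwork V. \<forall>g\<in>vcomm V. \<forall>b.
        case vdelta V q a w g b of (q', w', g', di, dw) \<Rightarrow>
          q' \<in> vstates V \<and> w' \<in> vwork V \<and> g' \<in> vcomm V \<and>
          (a = LeftEnd \<longrightarrow> di \<noteq> GoLeft) \<and> (a = RightEnd \<longrightarrow> di \<noteq> GoRight))"


section \<open>Provers\<close>

text \<open>
  \<open>P x h m\<close> is the reply to the message \<open>m\<close> on input \<open>x\<close>, where \<open>h\<close> lists the earlier exchanges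
  (verifier's message, prover's reply) in chronological order.
\<close>

type_synonym ('a, 'g) prover = "'a list \<Rightarrow> ('g \<times> 'g) list \<Rightarrow> 'g \<Rightarrow> 'g"

definition provers :: "('a, 'q, 'w, 'g) verifier \<Rightarrow> ('a, 'g) prover set" where
  "provers V = {P. \<forall>x h m. P x h m \<in> vcomm V}"

text \<open>The \<open>n\<close>-th reply of a one-way prover is the \<open>n\<close>-th symbol of a certificate \<open>c x\<close>.\<close>

definition oneway_provers :: "('a, 'q, 'w, 'g) verifier \<Rightarrow> ('a, 'g) prover set" where
  "oneway_provers V = {P \<in> provers V. \<exists>c. \<forall>x h m. P x h m = c x (length h)}"


section \<open>Computations\<close>

record ('q, 'w, 'g) config =
  cstate :: 'q
  cipos :: nat
  cwpos :: int
  cwork :: "int \<Rightarrow> 'w"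
  ccell :: 'g
  ctosses :: nat
  chist :: "('g \<times> 'g) list"

definition init_config :: "('a, 'q, 'w, 'g) verifier \<Rightarrow> ('q, 'w, 'g) config" where
  "init_config V =
     \<lparr>cstate = vstart V, cipos = 0, cwpos = 0, cwork = (\<lambda>_. vblank V),
      ccell = vnull V, ctosses = 0, chist = []\<rparr>"

fun move_input :: "direction \<Rightarrow> nat \<Rightarrow> nat" where
  "move_input GoLeft i = i - 1"
| "move_input Stay i = i"
| "move_input GoRight i = i + 1"

fun move_work :: "direction \<Rightarrow> int \<Rightarrow> int" where
  "move_work GoLeft i = i - 1"
| "move_work Stay i = i"
| "move_work GoRight i = i + 1"

text \<open>
  Writing the null symbol means that nothing is sent: the prover neither replies nor notices the
  step.  Any other symbol is a message, which the prover overwrites with its reply.  The random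
  bits \<open>\<omega>\<close> are private, since the prover sees only the exchanged messages.
\<close>

definition step ::
  "('a, 'q, 'w, 'g) verifier \<Rightarrow> ('a, 'g) prover \<Rightarrow> 'a list \<Rightarrow> (nat \<Rightarrow> bool)
     \<Rightarrow> ('q, 'w, 'g) config \<Rightarrow> ('q, 'w, 'g) config" where
  "step V P x \<omega> C =
     (if cstate C = vaccept V \<or> cstate C = vreject V then C
      else
        let toss = (cstate C \<in> vcoin V);
            b = (if toss then Some (\<omega> (ctosses C)) else None);
            (q', w', m, di, dw) =
              vdelta V (cstate C) (input_tape x (cipos C)) (cwork C (cwpos C)) (ccell C) b;
            reply = P x (chist C) m
        in \<lparr>cstate = q',
            cipos = move_input di (cipos C),
            cwpos = move_work dw (cwpos C),
            cwork = (cwork C)(cwpos C := w'),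
            ccell = (if m = vnull V then vnull V else reply),
            ctosses = (if toss then ctosses C + 1 else ctosses C),
            chist = (if m = vnull V then chist C else chist C @ [(m, reply)])\<rparr>)"

definition run ::
  "('a, 'q, 'w, 'g) verifier \<Rightarrow> ('a, 'g) prover \<Rightarrow> 'a list \<Rightarrow> (nat \<Rightarrow> bool)
     \<Rightarrow> nat \<Rightarrow> ('q, 'w, 'g) config" where
  "run V P x \<omega> t = (step V P x \<omega> ^^ t) (init_config V)"


section \<open>Interactive proof systems\<close>

definition fair_bits :: "(nat \<Rightarrow> bool) measure" where
  "fair_bits = Pi\<^sub>M UNIV (\<lambda>_. measure_pmf (bernoulli_pmf (1 / 2)))"

definition accept_prob :: "('a, 'q, 'w, 'g) verifier \<Rightarrow> ('a, 'g) prover \<Rightarrow> 'a list \<Rightarrow> real" where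
  "accept_prob V P x = measure fair_bits {\<omega>. \<exists>t. cstate (run V P x \<omega> t) = vaccept V}"

definition reject_prob :: "('a, 'q, 'w, 'g) verifier \<Rightarrow> ('a, 'g) prover \<Rightarrow> 'a list \<Rightarrow> real" where
  "reject_prob V P x = measure fair_bits {\<omega>. \<exists>t. cstate (run V P x \<omega> t) = vreject V}"

text \<open>
  \<open>Ps\<close> is the set of admissible provers, i.e. \<open>provers V\<close> or \<open>oneway_provers V\<close>.
\<close>

definition proof_system ::
  "('a, 'q, 'w, 'g) verifier \<Rightarrow> ('a, 'g) prover set \<Rightarrow> real \<Rightarrow> 'a list set \<Rightarrow> bool" where
  "proof_system V Ps \<epsilon> L \<longleftrightarrow>
     (\<exists>P\<in>Ps. \<forall>x\<in>L. accept_prob V P x \<ge> 1 - \<epsilon>) \<and>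
     (\<forall>P\<in>Ps. \<forall>x. x \<notin> L \<longrightarrow> reject_prob V P x \<ge> 1 - \<epsilon>)"


section \<open>Resource restrictions\<close>

text \<open>The bounds are worst-case over all inputs, admissible provers and random bits.\<close>

definition cons_space :: "('a, 'q, 'w, 'g) verifier \<Rightarrow> ('a, 'g) prover set \<Rightarrow> bool" where
  "cons_space V Ps \<longleftrightarrow>
     (\<exists>s::nat. \<forall>P\<in>Ps. \<forall>x \<omega> t. card ((\<lambda>i. cwpos (run V P x \<omega> i)) ` {..t}) \<le> s)"

definition cons_random_bits :: "('a, 'q, 'w, 'g) verifier \<Rightarrow> ('a, 'g) prover set \<Rightarrow> bool" where
  "cons_random_bits V Ps \<longleftrightarrow>
     (\<exists>r::nat. \<forall>P\<in>Ps. \<forall>x \<omega> t. ctosses (run V P x \<omega> t) \<le> r)"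

definition oneway_input :: "('a, 'q, 'w, 'g) verifier \<Rightarrow> ('a, 'g) prover set \<Rightarrow> bool" where
  "oneway_input V Ps \<longleftrightarrow>
     (\<forall>P\<in>Ps. \<forall>x \<omega> t. cipos (run V P x \<omega> t) \<le> cipos (run V P x \<omega> (Suc t)))"


section \<open>Complexity classes\<close>

text \<open>
  States and symbols are natural numbers: the finite sets of a verifier or an automaton can always
  be renamed into \<open>nat\<close>.
\<close>

type_synonym 'a restriction =
  "('a, nat, nat, nat) verifier \<Rightarrow> ('a, nat) prover set \<Rightarrow> bool"

definition IP :: "'a restriction set \<Rightarrow> 'a list set set" where
  "IP Rs = {L. \<exists>V \<epsilon>. is_verifier V \<and> \<epsilon> < 1 / 2 \<and> (\<forall>R\<in>Rs. R V (provers V)) \<and>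
                     proof_system V (provers V) \<epsilon> L}"

definition oneway_IP :: "'a restriction set \<Rightarrow> 'a list set set" where
  "oneway_IP Rs = {L. \<exists>V \<epsilon>. is_verifier V \<and> \<epsilon> < 1 / 2 \<and> (\<forall>R\<in>Rs. R V (oneway_provers V)) \<and>
                            proof_system V (oneway_provers V) \<epsilon> L}"


section \<open>One-way multihead finite automata\<close>

text \<open>
  A transition \<open>(q, as, q', ms)\<close> is applicable in state \<open>q\<close> if the \<open>i\<close>-th head scans \<open>as ! i\<close>; it
  enters \<open>q'\<close> and moves the \<open>i\<close>-th head to the right if \<open>ms ! i\<close>, leaving it in place otherwise.
\<close>

record ('a, 'q) multihead_nfa =
  nstates :: "'q set"
  nstart :: 'q
  nfinal :: "'q set"
  ntrans :: "('q \<times> 'a tape_symbol list \<times> 'q \<times> bool list) set"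

definition is_oneway_nfa :: "nat \<Rightarrow> ('a, 'q) multihead_nfa \<Rightarrow> bool" where
  "is_oneway_nfa k M \<longleftrightarrow>
     finite (nstates M) \<and> nstart M \<in> nstates M \<and> nfinal M \<subseteq> nstates M \<and>
     (\<forall>(q, as, q', ms)\<in>ntrans M.
        q \<in> nstates M \<and> q' \<in> nstates M \<and> length as = k \<and> length ms = k \<and>
        (\<forall>i<k. as ! i = RightEnd \<longrightarrow> \<not> ms ! i))"

definition nfa_step ::
  "('a, 'q) multihead_nfa \<Rightarrow> 'a list \<Rightarrow> 'q \<times> nat list \<Rightarrow> 'q \<times> nat list \<Rightarrow> bool" where
  "nfa_step M x C C' \<longleftrightarrow>
     (\<exists>ms. (fst C, map (input_tape x) (snd C), fst C', ms) \<in> ntrans M \<and>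
           snd C' = map2 (\<lambda>p m. if m then p + 1 else p) (snd C) ms)"

definition nfa_language :: "nat \<Rightarrow> ('a, 'q) multihead_nfa \<Rightarrow> 'a list set" where
  "nfa_language k M =
     {x. \<exists>q ps. (nfa_step M x)\<^sup>*\<^sup>* (nstart M, replicate k 0) (q, ps) \<and> q \<in> nfinal M}"

definition oneNFA :: "nat \<Rightarrow> 'a list set set" where
  "oneNFA k = {L. \<exists>M::('a, nat) multihead_nfa. is_oneway_nfa k M \<and> L = nfa_language k M}"

end

(*
  From automata to verifiers: the prover announces the transitions of an accepting run, and the
  verifier tosses k + 1 coins.  On 2^k - 1 outcomes it rejects at once; on each of the other
  2^k + 1 outcomes it picks one of the k heads and checks the announcements against the symbols
  scanned by this head alone.  An honest certificate is then accepted with probability just above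
  1/2.  A false one is exposed by at least one head, hence by two further outcomes, which lifts the
  rejection probability just above 1/2.  A prover cannot stall: the verifier limits the announced
  steps in which no head moves, so an endless certificate would push some head beyond the right
  end-marker.

  From verifiers to automata: if at most r coins are tossed, the verifier behaves like 2^r
  deterministic machines with finite control, one per outcome, each with a one-way input head.
  The automaton simulates them all and guesses the replies round by round, where the n-th round
  contains the n-th exchange of every machine.  A prover exists for the guessed replies if machines
  with the same history and message get the same reply (in the one-way case: if all replies of a
  round agree), which the automaton checks by remembering which machines share their history.
  Within a round the machines are scheduled nondeterministically, so those that loop
  do no harm, and the automaton accepts once more than half of the machines have accepted.
*)

theory Submission
  imports Defs
begin

section \<open>Tossing boundedly many coins\<close>

text \<open>Outcomes of \<open>r\<close> tosses are numbered, so that they can index the heads of an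
  automaton and so that a verifier can pick a head by arithmetic on the outcome.\<close>

definition coins :: "nat \<Rightarrow> nat \<Rightarrow> bool list" where
  "coins r p = List.n_lists r [False, True] ! p"

lemma length_n_lists_bool: "length (List.n_lists r [False, True]) = 2 ^ r"
  by (simp add: length_n_lists numeral_2_eq_2)

lemma bij_betw_coins: "bij_betw (coins r) {..<2 ^ r} {bs. length bs = r}"
proof -
  have "bij_betw (coins r) {..<length (List.n_lists r [False, True])}
          (set (List.n_lists r [False, True]))"
    unfolding coins_def by (intro bij_betw_nth distinct_n_lists) auto
  moreover have "set (List.n_lists r [False, True]) = {bs. length bs = r}"
    by (auto simp: set_n_lists)
  ultimately show ?thesis
    by (simp add: length_n_lists_bool)
qed

lemma length_coins: "p < 2 ^ r \<Longrightarrow> length (coins r p) = r"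
  using bij_betw_coins[of r] by (auto simp: bij_betw_def)

text \<open>A cylinder is a basic set of the product measure with \<open>r\<close> fixed
  coordinates, so its measure is a product of \<open>r\<close> factors 1/2.\<close>

lemma measure_fair_bits_cylinder:
  assumes "length bs = r"
  shows "measure fair_bits {\<omega>. map \<omega> [0..<r] = bs} = 1 / 2 ^ r"
    and "{\<omega>. map \<omega> [0..<r] = bs} \<in> sets fair_bits"
proof -
  let ?M = "\<lambda>_::nat. measure_pmf (bernoulli_pmf (1 / 2))"
  interpret product_prob_space ?M UNIV
    by unfold_locales
  have "\<omega> \<in> prod_emb UNIV ?M {..<r} (PiE {..<r} (\<lambda>j. {bs ! j})) \<longleftrightarrow> (\<forall>j<r. \<omega> j = bs ! j)" for \<omega>
    by (simp add: prod_emb_def PiE_iff Ball_def)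
  moreover have "map \<omega> [0..<r] = bs \<longleftrightarrow> (\<forall>j<r. \<omega> j = bs ! j)" for \<omega>
    using assms by (simp add: list_eq_iff_nth_eq)
  ultimately have eq: "{\<omega>. map \<omega> [0..<r] = bs} = prod_emb UNIV ?M {..<r} (PiE {..<r} (\<lambda>j. {bs ! j}))"
    by blast
  have half: "measure (?M j) {b} = 1 / 2" for b j
    by (cases b) (simp_all add: measure_pmf_single)
  have "measure (Pi\<^sub>M UNIV ?M) (prod_emb UNIV ?M {..<r} (PiE {..<r} (\<lambda>j. {bs ! j})))
      = (\<Prod>j\<in>{..<r}. measure (?M j) {bs ! j})"
    by (rule measure_PiM_emb) simp_all
  then show "measure fair_bits {\<omega>. map \<omega> [0..<r] = bs} = 1 / 2 ^ r"
    unfolding fair_bits_def eq half by (simp add: power_one_over)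
  show "{\<omega>. map \<omega> [0..<r] = bs} \<in> sets fair_bits"
    unfolding fair_bits_def eq by (rule sets_PiM_I) simp_all
qed

text \<open>Such an event is a finite disjoint union of cylinders of equal measure.\<close>

lemma measure_fair_bits_prefix:
  "measure fair_bits {\<omega>. Q (map \<omega> [0..<r])} = card {p. p < 2 ^ r \<and> Q (coins r p)} / 2 ^ r"
proof -
  let ?S = "{bs. length bs = r \<and> Q bs}"
  let ?C = "\<lambda>bs. {\<omega>::nat \<Rightarrow> bool. map \<omega> [0..<r] = bs}"
  have fin: "finite ?S"
    by (rule finite_subset[OF _ finite_lists_length_eq[of "UNIV :: bool set" r]]) auto
  have "{\<omega>. Q (map \<omega> [0..<r])} = (\<Union>bs\<in>?S. ?C bs)"
    by auto
  also have "measure fair_bits \<dots> = (\<Sum>bs\<in>?S. measure fair_bits (?C bs))"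
  proof (rule measure_UNION'[OF fin])
    interpret prob_space fair_bits
      unfolding fair_bits_def by (intro prob_space_PiM prob_space_measure_pmf)
    show "?C bs \<in> fmeasurable fair_bits" if "bs \<in> ?S" for bs
      using that measure_fair_bits_cylinder(2)[of bs r] by (simp add: fmeasurable_eq_sets)
    show "pairwise (\<lambda>bs bs'. disjnt (?C bs) (?C bs')) ?S"
      by (auto simp: pairwise_def disjnt_def)
  qed
  also have "\<dots> = card ?S / 2 ^ r"
    by (simp add: measure_fair_bits_cylinder(1))
  also have "card ?S = card {p. p < 2 ^ r \<and> Q (coins r p)}"
  proof (rule bij_betw_same_card[symmetric])
    have img: "coins r ` {..<2 ^ r} = {bs. length bs = r}" and inj: "inj_on (coins r) {..<2 ^ r}"
      using bij_betw_coins[of r] by (auto simp: bij_betw_def)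
    have "coins r ` {p. p < 2 ^ r \<and> Q (coins r p)} = ?S"
    proof (intro subset_antisym subsetI)
      fix bs assume "bs \<in> ?S"
      moreover from this obtain p where "p < 2 ^ r" "bs = coins r p"
        using img by blast
      ultimately show "bs \<in> coins r ` {p. p < 2 ^ r \<and> Q (coins r p)}"
        by auto
    qed (auto simp: length_coins)
    moreover have "inj_on (coins r) {p. p < 2 ^ r \<and> Q (coins r p)}"
      using inj by (rule inj_on_subset) auto
    ultimately show "bij_betw (coins r) {p. p < 2 ^ r \<and> Q (coins r p)} ?S"
      by (simp add: bij_betw_def)
  qed
  finally show ?thesis .
qed

section \<open>Runs determined by their first random bits\<close>

lemma run_0: "run V P x \<omega> 0 = init_config V"
  by (simp add: run_def)

lemma run_Suc: "run V P x \<omega> (Suc t) = step V P x \<omega> (run V P x \<omega> t)"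
  by (simp add: run_def)

text \<open>A step that reads bit number \<open>ctosses C\<close> raises the counter, so the bound
  on the counter makes this number smaller than \<open>r\<close>. The bound is assumed for
  \<open>\<omega>\<close> alone, since both runs coincide up to the step under
  consideration.\<close>

lemma run_cong:
  assumes "\<And>t. ctosses (run V P x \<omega> t) \<le> r" and "\<And>j. j < r \<Longrightarrow> \<omega> j = \<omega>' j"
  shows "run V P x \<omega> t = run V P x \<omega>' t"
proof (induction t)
  case (Suc t)
  let ?C = "run V P x \<omega> t"
  have "step V P x \<omega> ?C = step V P x \<omega>' ?C"
  proof (cases "cstate ?C = vaccept V \<or> cstate ?C = vreject V \<or> cstate ?C \<notin> vcoin V")
    case True
    then show ?thesis by (auto simp: step_def)
  next
    case False
    then have "ctosses (run V P x \<omega> (Suc t)) = Suc (ctosses ?C)"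
      by (simp add: run_Suc step_def Let_def split: prod.split)
    then have "ctosses ?C < r"
      using assms(1)[of "Suc t"] by simp
    then show ?thesis
      using assms(2)[of "ctosses ?C"] by (simp only: step_def Let_def)
  qed
  then show ?case
    by (simp add: run_Suc Suc.IH)
qed (simp add: run_0)

text \<open>Probability becomes counting: a verifier with at most \<open>r\<close> tosses is a
  family of \<open>2 ^ r\<close> deterministic machines. In \<open>(!) (coins r p)\<close> the
  values from position \<open>r\<close> on are arbitrary, but they are never read.\<close>

lemma measure_run_state:
  assumes "\<And>\<omega> t. ctosses (run V P x \<omega> t) \<le> r"
  shows "measure fair_bits {\<omega>. \<exists>t. cstate (run V P x \<omega> t) = q}
       = card {p. p < 2 ^ r \<and> (\<exists>t. cstate (run V P x ((!) (coins r p)) t) = q)} / 2 ^ r"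
proof -
  have eq: "run V P x \<omega> = run V P x ((!) (map \<omega> [0..<r]))" for \<omega>
    by (rule ext, rule run_cong[OF assms]) simp
  have "{\<omega>. \<exists>t. cstate (run V P x \<omega> t) = q}
      = {\<omega>. \<exists>t. cstate (run V P x ((!) (map \<omega> [0..<r])) t) = q}"
    by (rule Collect_cong, subst (1) eq) (rule refl)
  also have "measure fair_bits \<dots>
       = card {p. p < 2 ^ r \<and> (\<exists>t. cstate (run V P x ((!) (coins r p)) t) = q)} / 2 ^ r"
    by (rule measure_fair_bits_prefix[of "\<lambda>bs. \<exists>t. cstate (run V P x ((!) bs) t) = q" r])
  finally show ?thesis .
qed

section \<open>Products of machines reading letters in rounds\<close>

text \<open>The product automaton below has structured control states, whereas \<open>oneNFA\<close>
  asks for natural numbers; an injection on the finite state set renames them.\<close>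

lemma nfa_language_in_oneNFA:
  fixes M :: "('a, 'c) multihead_nfa"
  assumes M: "is_oneway_nfa k M"
  shows "nfa_language k M \<in> oneNFA k"
proof -
  obtain f :: "'c \<Rightarrow> nat" where f: "inj_on f (nstates M)"
    using M finite_imp_inj_to_nat_seg[of "nstates M"] unfolding is_oneway_nfa_def by blast
  define M' :: "('a, nat) multihead_nfa" where
    "M' = \<lparr>nstates = f ` nstates M, nstart = f (nstart M), nfinal = f ` nfinal M,
           ntrans = (\<lambda>(q, as, q', ms). (f q, as, f q', ms)) ` ntrans M\<rparr>"
  have trans_states: "q \<in> nstates M \<and> q' \<in> nstates M" if "(q, as, q', ms) \<in> ntrans M" for q as q' ms
    using M that unfolding is_oneway_nfa_def by fast
  have start: "nstart M \<in> nstates M" and final: "nfinal M \<subseteq> nstates M"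
    using M by (auto simp: is_oneway_nfa_def)
  have "is_oneway_nfa k M'"
    using M unfolding is_oneway_nfa_def M'_def by fastforce
  moreover have fwd: "(nfa_step M' x)\<^sup>*\<^sup>* (f (nstart M), ps0) (f (fst C), snd C) \<and> fst C \<in> nstates M"
    if "(nfa_step M x)\<^sup>*\<^sup>* (nstart M, ps0) C" for x C ps0
    using that
  proof (induction rule: rtranclp_induct)
    case (step C D)
    then obtain ms where "(fst C, map (input_tape x) (snd C), fst D, ms) \<in> ntrans M"
        "snd D = map2 (\<lambda>p m. if m then p + 1 else p) (snd C) ms"
      unfolding nfa_step_def by blast
    then have "nfa_step M' x (f (fst C), snd C) (f (fst D), snd D)" "fst D \<in> nstates M"
      using trans_states unfolding nfa_step_def M'_def by force+
    then show ?case
      using step.IH by (auto intro: rtranclp.rtrancl_into_rtrancl)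
  qed (use start in auto)
  moreover have bwd: "\<exists>q\<in>nstates M. fst C = f q \<and> (nfa_step M x)\<^sup>*\<^sup>* (nstart M, ps0) (q, snd C)"
    if "(nfa_step M' x)\<^sup>*\<^sup>* (f (nstart M), ps0) C" for x C ps0
    using that
  proof (induction rule: rtranclp_induct)
    case (step C D)
    then obtain q where q: "q \<in> nstates M" "fst C = f q"
        "(nfa_step M x)\<^sup>*\<^sup>* (nstart M, ps0) (q, snd C)"
      by blast
    obtain q1 q' ms where t: "(q1, map (input_tape x) (snd C), q', ms) \<in> ntrans M"
        "f q1 = f q" "fst D = f q'" "snd D = map2 (\<lambda>p m. if m then p + 1 else p) (snd C) ms"
      using step.hyps(2) q(2) unfolding nfa_step_def M'_def by force
    \<comment> \<open>The step of \<open>M'\<close> might stem from another preimage of the current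
      state; injectivity on \<open>nstates M\<close> excludes this.\<close>
    then have "q1 = q"
      using f q(1) trans_states by (meson inj_onD)
    then have "nfa_step M x (q, snd C) (q', snd D)"
      using t unfolding nfa_step_def by auto
    then show ?case
      using t q trans_states by (meson rtranclp.rtrancl_into_rtrancl)
  qed (use start in auto)
  have "nfa_language k M = nfa_language k M'"
  proof (intro set_eqI iffI)
    fix x assume "x \<in> nfa_language k M"
    then show "x \<in> nfa_language k M'"
      using fwd[where x = x and ?ps0.0 = "replicate k 0"]
      by (fastforce simp: nfa_language_def M'_def)
  next
    fix x assume "x \<in> nfa_language k M'"
    then obtain q ps where "(nfa_step M' x)\<^sup>*\<^sup>* (f (nstart M), replicate k 0) (q, ps)" "q \<in> f ` nfinal M"
      by (auto simp: nfa_language_def M'_def)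
    moreover from this obtain q' where "q' \<in> nstates M" "q = f q'"
        "(nfa_step M x)\<^sup>*\<^sup>* (nstart M, replicate k 0) (q', ps)"
      using bwd[where x = x and C = "(q, ps)"] by auto
    moreover have "q' \<in> nfinal M"
      using calculation f final by (auto simp: inj_on_def)
    ultimately show "x \<in> nfa_language k M"
      by (auto simp: nfa_language_def)
  qed
  ultimately show ?thesis
    unfolding oneNFA_def by blast
qed

section \<open>Construction of the product automaton\<close>

lemma map2_move_single:
  assumes "length ps = K" "p < K"
  shows "map2 (\<lambda>p m. if m then p + 1 else p) ps ((replicate K False)[p := mv])
       = ps[p := if mv then ps ! p + 1 else ps ! p :: nat]"
  using assms by (intro nth_equalityI) (auto simp: nth_list_update)

lemma map2_move_none:
  assumes "length ps = K"
  shows "map2 (\<lambda>p m. if m then p + 1 else p) ps (replicate K False) = (ps :: nat list)"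
  using assms by (intro nth_equalityI) auto

text \<open>A pending letter becomes a word of length at most one, so that consuming it is a matter
  of concatenation.\<close>

definition opt_list :: "'c option \<Rightarrow> 'c list" where
  "opt_list z = (case z of None \<Rightarrow> [] | Some c \<Rightarrow> [c])"

lemma opt_list_simps [simp]: "opt_list None = []" "opt_list (Some c) = [c]"
  by (simp_all add: opt_list_def)

lemma opt_list_inject [simp]: "opt_list z = opt_list z' \<longleftrightarrow> z = z'"
  by (cases z; cases z') auto

text \<open>
  \<open>K\<close> machines, each with its own one-way head, read letters supplied in rounds.  In a round,
  machine \<open>p\<close> is offered at most one letter, the \<open>p\<close>-th entry of a list \<open>\<sigma>\<close>; which lists may be
  offered is controlled by the finite automaton given by \<open>e0\<close>, \<open>ok\<close> and \<open>upd\<close>.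
\<close>

locale letter_rounds =
  fixes K :: nat and Loc :: "'l set" and l0 :: 'l
    and pstep :: "nat \<Rightarrow> 'l \<Rightarrow> 'a tape_symbol \<Rightarrow> 'c list \<Rightarrow> 'l \<Rightarrow> bool \<Rightarrow> bool"
    and Sig :: "'c set" and ES :: "'e set" and e0 :: 'e
    and ok :: "'e \<Rightarrow> 'c option list \<Rightarrow> bool" and upd :: "'e \<Rightarrow> 'c option list \<Rightarrow> 'e"
    and F :: "'l list \<Rightarrow> bool"
  assumes finite_Loc: "finite Loc" and l0: "l0 \<in> Loc" and finite_Sig: "finite Sig"
    and finite_ES: "finite ES" and e0: "e0 \<in> ES"
    and pstep: "pstep p l a cs l' mv \<Longrightarrow> l' \<in> Loc \<and> length cs \<le> 1 \<and> (a = RightEnd \<longrightarrow> \<not> mv)"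
    and upd: "e \<in> ES \<Longrightarrow> upd e \<sigma> \<in> ES"
begin

inductive reads :: "nat \<Rightarrow> 'a list \<Rightarrow> 'l \<Rightarrow> nat \<Rightarrow> 'c list \<Rightarrow> 'l \<Rightarrow> nat \<Rightarrow> bool" for p x l i where
  reads_Nil: "reads p x l i [] l i"
| reads_step: "reads p x l i cs l' i' \<Longrightarrow> pstep p l' (input_tape x i') c l'' mv
     \<Longrightarrow> reads p x l i (cs @ c) l'' (if mv then i' + 1 else i')"

definition offers :: "'c option list set" where
  "offers = {\<sigma>. length \<sigma> = K \<and> set \<sigma> \<subseteq> insert None (Some ` Sig)}"

inductive admissible :: "'c option list list \<Rightarrow> 'e \<Rightarrow> bool" where
  admissible_Nil: "admissible [] e0"
| admissible_snoc: "admissible w e \<Longrightarrow> \<sigma> \<in> offers \<Longrightarrow> ok e \<sigma> \<Longrightarrow> admissible (w @ [\<sigma>]) (upd e \<sigma>)"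

text \<open>Rounds without a letter for machine \<open>p\<close> leave no trace here: the
  \<open>n\<close>-th letter belongs to the \<open>n\<close>-th round only if the controller
  enforces it.\<close>

definition track :: "nat \<Rightarrow> 'c option list list \<Rightarrow> 'c list" where
  "track p w = concat (map (\<lambda>\<sigma>. opt_list (\<sigma> ! p)) w)"

text \<open>The second component is the part of the current round that the machines have not yet
  consumed.\<close>

definition controls :: "('l list \<times> 'c option list \<times> 'e) set" where
  "controls = {ls. length ls = K \<and> set ls \<subseteq> Loc} \<times> offers \<times> ES"

text \<open>Either one machine makes a step and moves at most its own head, or a new round begins,
  which requires that all letters of the previous round are consumed. The equation with
  \<open>opt_list\<close> lets a step consume nothing or the whole pending letter.\<close>

definition moves ::
  "(('l list \<times> 'c option list \<times> 'e) \<times> 'a tape_symbol list \<times> ('l list \<times> 'c option list \<times> 'e) \<times> bool list) set"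
where
  "moves =
     {((ls, \<sigma>, e), as, (ls[p := l'], \<sigma>[p := z], e), (replicate K False)[p := mv]) | ls \<sigma> e as p l' z mv cs.
        (ls, \<sigma>, e) \<in> controls \<and> length as = K \<and> p < K \<and>
        pstep p (ls ! p) (as ! p) cs l' mv \<and> opt_list (\<sigma> ! p) = cs @ opt_list z} \<union>
     {((ls, replicate K None, e), as, (ls, \<sigma>, upd e \<sigma>), replicate K False) | ls \<sigma> e as.
        (ls, replicate K None, e) \<in> controls \<and> length as = K \<and> \<sigma> \<in> offers \<and> ok e \<sigma>}"

definition product_nfa :: "('a, 'l list \<times> 'c option list \<times> 'e) multihead_nfa" where
  "product_nfa = \<lparr>nstates = controls, nstart = (replicate K l0, replicate K None, e0),
     nfinal = {(ls, \<sigma>, e) \<in> controls. F ls}, ntrans = moves\<rparr>"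

lemma finite_controls: "finite controls"
proof -
  have "offers = {\<sigma>. set \<sigma> \<subseteq> insert None (Some ` Sig) \<and> length \<sigma> = K}"
    by (auto simp: offers_def)
  moreover have "{ls. length ls = K \<and> set ls \<subseteq> Loc} = {ls. set ls \<subseteq> Loc \<and> length ls = K}"
    by auto
  ultimately show ?thesis
    unfolding controls_def
    by (simp add: finite_lists_length_eq finite_Loc finite_Sig finite_ES)
qed

lemma none_offer: "replicate K None \<in> offers"
  by (auto simp: offers_def)

lemma offers_update:
  assumes "\<sigma> \<in> offers" "p < K" "opt_list (\<sigma> ! p) = cs @ opt_list z"
  shows "\<sigma>[p := z] \<in> offers"
proof -
  have "z = None \<or> z = \<sigma> ! p"
    using assms(3) by (cases "\<sigma> ! p"; cases z) (auto simp: Cons_eq_append_conv)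
  then show ?thesis
    using assms by (auto simp: offers_def list_update_id dest: set_update_subset_insert[THEN subsetD])
qed

lemma controls_update:
  assumes "(ls, \<sigma>, e) \<in> controls" "p < K" "l' \<in> Loc" "opt_list (\<sigma> ! p) = cs @ opt_list z"
  shows "(ls[p := l'], \<sigma>[p := z], e) \<in> controls"
  using assms offers_update[OF _ assms(2,4)]
  by (auto simp: controls_def dest!: set_update_subset_insert[THEN subsetD])

lemma is_oneway_product_nfa: "is_oneway_nfa K product_nfa"
proof -
  have start: "(replicate K l0, replicate K None, e0) \<in> controls"
    using l0 e0 none_offer by (auto simp: controls_def)
  have "s \<in> controls \<and> s' \<in> controls \<and> length as = K \<and> length ms = K \<and>
      (\<forall>i<K. as ! i = RightEnd \<longrightarrow> \<not> ms ! i)" if "(s, as, s', ms) \<in> moves" for s as s' ms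
    using that unfolding moves_def
  proof (elim UnE CollectE exE conjE)
    fix ls \<sigma> e as' p l' z mv cs
    assume "(s, as, s', ms) = ((ls, \<sigma>, e), as', (ls[p := l'], \<sigma>[p := z], e), (replicate K False)[p := mv])"
      and c: "(ls, \<sigma>, e) \<in> controls" "length as' = K" "p < K"
        "pstep p (ls ! p) (as' ! p) cs l' mv" "opt_list (\<sigma> ! p) = cs @ opt_list z"
    then show ?thesis
      using pstep[OF c(4)] controls_update[OF c(1,3) _ c(5)] by (auto simp: nth_list_update)
  next
    fix ls \<sigma> e as'
    assume "(s, as, s', ms) = ((ls, replicate K None, e), as', (ls, \<sigma>, upd e \<sigma>), replicate K False)"
      and "(ls, replicate K None, e) \<in> controls" "length as' = K" "\<sigma> \<in> offers" "ok e \<sigma>"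
    then show ?thesis
      using upd by (auto simp: controls_def)
  qed
  then show ?thesis
    using start finite_controls unfolding is_oneway_nfa_def product_nfa_def by auto
qed

section \<open>Soundness and completeness of the product automaton\<close>

lemma track_Nil [simp]: "track p [] = []"
  by (simp add: track_def)

lemma track_snoc [simp]: "track p (w @ [\<sigma>]) = track p w @ opt_list (\<sigma> ! p)"
  by (simp add: track_def)

text \<open>Induction along the run: what machine \<open>p\<close> has read is its track without the
  letter still pending, and only the start of a round extends \<open>w\<close>.\<close>

lemma product_nfa_sound:
  assumes "(nfa_step product_nfa x)\<^sup>*\<^sup>* (nstart product_nfa, replicate K 0) C"
  shows "case C of ((ls, \<sigma>, e), ps) \<Rightarrow> (ls, \<sigma>, e) \<in> controls \<and> length ps = K \<and>
    (\<exists>w. admissible w e \<and>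
      (\<forall>p<K. \<exists>cs. reads p x l0 0 cs (ls ! p) (ps ! p) \<and> track p w = cs @ opt_list (\<sigma> ! p)))"
  using assms
proof (induction rule: rtranclp_induct)
  case base
  have "(replicate K l0, replicate K None, e0) \<in> controls"
    using is_oneway_product_nfa by (simp add: is_oneway_nfa_def product_nfa_def)
  then show ?case
    by (auto simp: product_nfa_def intro!: exI[of _ "[]"] admissible_Nil reads_Nil)
next
  case (step C D)
  obtain ls \<sigma> e ps where C: "C = ((ls, \<sigma>, e), ps)"
    by (metis surj_pair)
  obtain ls' \<sigma>' e' ps' where D: "D = ((ls', \<sigma>', e'), ps')"
    by (metis surj_pair)
  from step.IH C obtain w where IH: "(ls, \<sigma>, e) \<in> controls" "length ps = K" "admissible w e"
    "\<And>p. p < K \<Longrightarrow> \<exists>cs. reads p x l0 0 cs (ls ! p) (ps ! p) \<and> track p w = cs @ opt_list (\<sigma> ! p)"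
    by auto
  have len: "length ls = K" "length \<sigma> = K"
    using IH(1) by (auto simp: controls_def offers_def)
  obtain ms where t: "((ls, \<sigma>, e), map (input_tape x) ps, (ls', \<sigma>', e'), ms) \<in> moves"
      and ps': "ps' = map2 (\<lambda>p m. if m then p + 1 else p) ps ms"
    using step.hyps(2) by (auto simp: nfa_step_def C D product_nfa_def)
  have ctrl: "(ls', \<sigma>', e') \<in> controls"
    using t is_oneway_product_nfa by (auto simp: is_oneway_nfa_def product_nfa_def)
  from t show ?case unfolding moves_def
  proof (elim UnE CollectE exE conjE)
    fix lsa \<sigma>a ea as' p l' z mv cs
    assume "((ls, \<sigma>, e), map (input_tape x) ps, (ls', \<sigma>', e'), ms) =
        ((lsa, \<sigma>a, ea), as', (lsa[p := l'], \<sigma>a[p := z], ea), (replicate K False)[p := mv])"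
      and "p < K" "pstep p (lsa ! p) (as' ! p) cs l' mv" "opt_list (\<sigma>a ! p) = cs @ opt_list z"
    then have s: "p < K" "pstep p (ls ! p) (input_tape x (ps ! p)) cs l' mv"
        "opt_list (\<sigma> ! p) = cs @ opt_list z" "ls' = ls[p := l']" "\<sigma>' = \<sigma>[p := z]" "e' = e"
        "ms = (replicate K False)[p := mv]"
      using IH(2) by auto
    have ps'_eq: "ps' = ps[p := if mv then ps ! p + 1 else ps ! p]"
      unfolding ps' s using IH(2) s(1) by (rule map2_move_single)
    have "\<exists>cs. reads q x l0 0 cs (ls' ! q) (ps' ! q) \<and> track q w = cs @ opt_list (\<sigma>' ! q)"
      if "q < K" for q
    proof (cases "q = p")
      case True
      obtain cs0 where "reads p x l0 0 cs0 (ls ! p) (ps ! p)" "track p w = cs0 @ opt_list (\<sigma> ! p)"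
        using IH(4)[OF s(1)] by blast
      then show ?thesis
        using reads_step[OF _ s(2), of l0 0 cs0] s len IH(2)
        by (intro exI[of _ "cs0 @ cs"]) (simp add: True ps'_eq)
    next
      case False
      then show ?thesis
        using IH(4)[OF that] by (simp add: s ps'_eq)
    qed
    then show ?thesis
      using IH ctrl ps'_eq s by (auto simp: D)
  next
    fix lsa \<sigma>a ea as'
    assume "((ls, \<sigma>, e), map (input_tape x) ps, (ls', \<sigma>', e'), ms) =
        ((lsa, replicate K None, ea), as', (lsa, \<sigma>a, upd ea \<sigma>a), replicate K False)"
      and "\<sigma>a \<in> offers" "ok ea \<sigma>a"
    then have s: "\<sigma> = replicate K None" "ls' = ls" "e' = upd e \<sigma>'" "\<sigma>' \<in> offers" "ok e \<sigma>'"
        "ms = replicate K False"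
      by auto
    have "ps' = ps"
      unfolding ps' s using IH(2) by (rule map2_move_none)
    moreover have "admissible (w @ [\<sigma>']) e'"
      unfolding s(3) using IH(3) s by (intro admissible_snoc)
    ultimately show ?thesis
      using IH ctrl s by (auto simp: D intro!: exI[of _ "w @ [\<sigma>']"])
  qed
qed

text \<open>A step consumes at most one letter, so no step straddles the boundary between
  \<open>cs\<close> and \<open>ds\<close>.\<close>

lemma reads_split:
  assumes "reads p x l i (cs @ ds) l' i'"
  shows "\<exists>m j. reads p x l i cs m j \<and> reads p x m j ds l' i'"
  using assms
proof (induction "cs @ ds" l' i' arbitrary: ds rule: reads.induct)
  case reads_Nil
  then show ?case by (auto intro: reads.intros)
next
  case (reads_step es l' i' c l'' mv)
  show ?case
  proof (cases "ds = []")
    case True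
    then show ?thesis
      using reads.reads_step[OF reads_step.hyps(1,3)] reads_step.hyps(4)
      by (intro exI[of _ l''] exI[of _ "if mv then i' + 1 else i'"]) (simp add: reads_Nil)
  next
    case False
    have "length c \<le> 1"
      using pstep[OF reads_step.hyps(3)] by simp
    \<comment> \<open>As \<open>ds\<close> is nonempty, the last step consumes at most the final
      letter of \<open>ds\<close>.\<close>
    have "\<exists>ds'. es = cs @ ds' \<and> ds = ds' @ c"
    proof (cases c)
      case Nil
      then show ?thesis using reads_step.hyps(4) by auto
    next
      case (Cons y ys)
      then have "c = [y]" using \<open>length c \<le> 1\<close> by simp
      moreover obtain ds' d where "ds = ds' @ [d]"
        using False by (metis append_butlast_last_id)
      ultimately show ?thesis using reads_step.hyps(4) by auto
    qed
    then obtain ds' where "es = cs @ ds'" "ds = ds' @ c"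
      by blast
    then show ?thesis
      using reads_step.hyps(2)[of ds'] reads.reads_step[OF _ reads_step.hyps(3)] by blast
  qed
qed

text \<open>While one machine moves, all others rest; this embeds an isolated run into the
  product.\<close>

lemma product_nfa_run_one:
  assumes "reads p x l i cs l' i'" "(ls, \<sigma>, e) \<in> controls" "length ps = K" "p < K"
    "ls ! p = l" "ps ! p = i" "opt_list (\<sigma> ! p) = cs @ opt_list z"
  shows "(nfa_step product_nfa x)\<^sup>*\<^sup>* ((ls, \<sigma>, e), ps) ((ls[p := l'], \<sigma>[p := z], e), ps[p := i'])
     \<and> l' \<in> Loc"
  using assms(1,7)
proof (induction arbitrary: z rule: reads.induct)
  case reads_Nil
  then have "z = \<sigma> ! p" by simp
  moreover have "l \<in> Loc"
    using assms(2,4,5) by (auto simp: controls_def)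
  ultimately show ?case
    using assms(4-6) by (auto simp: list_update_id)
next
  case (reads_step cs l' i' c l'' mv)
  have ln: "length ls = K" "length \<sigma> = K"
    using assms(2) by (auto simp: controls_def offers_def)
  \<comment> \<open>This is the pending letter before the last step: if \<open>cs\<close> is empty,
    nothing has been consumed yet; otherwise \<open>cs\<close> has already taken the whole
    letter.\<close>
  obtain z' where z': "opt_list z' = c @ opt_list z"
  proof -
    have "\<exists>z'. opt_list z' = c @ opt_list z"
    proof (cases cs)
      case Nil
      then show ?thesis using reads_step.prems by (intro exI[of _ "\<sigma> ! p"]) simp
    next
      case (Cons y ys)
      then have "c @ opt_list z = []"
        using reads_step.prems by (cases "\<sigma> ! p") auto
      then show ?thesis by (intro exI[of _ None]) simp
    qed
    then show ?thesis using that by blast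
  qed
  let ?ls = "ls[p := l']" and ?\<sigma> = "\<sigma>[p := z']" and ?ps = "ps[p := i']"
  have 1: "(nfa_step product_nfa x)\<^sup>*\<^sup>* ((ls, \<sigma>, e), ps) ((?ls, ?\<sigma>, e), ?ps)" "l' \<in> Loc"
    using reads_step.IH[of z'] reads_step.prems z' by auto
  have ctrl: "(?ls, ?\<sigma>, e) \<in> controls"
    using assms(2,4) 1(2) by (rule controls_update[where cs = cs]) (use reads_step.prems z' in simp)
  have "((?ls, ?\<sigma>, e), map (input_tape x) ?ps, (?ls[p := l''], ?\<sigma>[p := z], e), (replicate K False)[p := mv])
      \<in> moves"
    unfolding moves_def using ctrl assms(3,4) reads_step.hyps(2) ln z'
    by (intro UnI1 CollectI exI[of _ ?ls] exI[of _ ?\<sigma>] exI[of _ e] exI[of _ "map (input_tape x) ?ps"]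
        exI[of _ p] exI[of _ l''] exI[of _ z] exI[of _ mv] exI[of _ c]) simp
  then have "nfa_step product_nfa x ((?ls, ?\<sigma>, e), ?ps)
      ((ls[p := l''], \<sigma>[p := z], e), ps[p := if mv then i' + 1 else i'])"
    unfolding nfa_step_def product_nfa_def
    using map2_move_single[of ?ps K p mv] assms(3,4)
    by (intro exI[of _ "(replicate K False)[p := mv]"]) simp
  then show ?case
    using 1 pstep[OF reads_step.hyps(2)] by (auto intro: rtranclp.rtrancl_into_rtrancl)
qed

text \<open>Within a round the machines can be scheduled one after another; after \<open>n\<close>
  turns the first \<open>n\<close> machines are done with the round.\<close>

lemma product_nfa_run_all:
  assumes "\<And>p. p < K \<Longrightarrow> reads p x (M p) (I p) (opt_list (\<sigma> ! p)) (L p) (J p)"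
    and ctrl: "(map M [0..<K], \<sigma>, e) \<in> controls"
  shows "(nfa_step product_nfa x)\<^sup>*\<^sup>* ((map M [0..<K], \<sigma>, e), map I [0..<K])
           ((map L [0..<K], replicate K None, e), map J [0..<K])
     \<and> (map L [0..<K], replicate K None, e) \<in> controls"
proof -
  let ?ls = "\<lambda>n. map (\<lambda>p. if p < n then L p else M p) [0..<K]"
  let ?\<sigma> = "\<lambda>n. map (\<lambda>p. if p < n then None else \<sigma> ! p) [0..<K]"
  let ?ps = "\<lambda>n. map (\<lambda>p. if p < n then J p else I p) [0..<K]"
  have \<sigma>: "length \<sigma> = K"
    using ctrl by (auto simp: controls_def offers_def)
  have *: "(nfa_step product_nfa x)\<^sup>*\<^sup>* ((map M [0..<K], \<sigma>, e), map I [0..<K]) ((?ls n, ?\<sigma> n, e), ?ps n)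
     \<and> (?ls n, ?\<sigma> n, e) \<in> controls" if "n \<le> K" for n
    using that
  proof (induction n)
    case 0
    have "?\<sigma> 0 = \<sigma>"
      using \<sigma> by (intro nth_equalityI) auto
    then show ?case using ctrl by simp
  next
    case (Suc n)
    then have n: "n < K" by simp
    have upds: "(?ls n)[n := L n] = ?ls (Suc n)" "(?\<sigma> n)[n := None] = ?\<sigma> (Suc n)"
        "(?ps n)[n := J n] = ?ps (Suc n)"
      using n by (auto intro!: nth_equalityI simp: nth_list_update)
    have IH: "(nfa_step product_nfa x)\<^sup>*\<^sup>* ((map M [0..<K], \<sigma>, e), map I [0..<K]) ((?ls n, ?\<sigma> n, e), ?ps n)"
        "(?ls n, ?\<sigma> n, e) \<in> controls"
      using Suc by auto
    have "(nfa_step product_nfa x)\<^sup>*\<^sup>* ((?ls n, ?\<sigma> n, e), ?ps n)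
       (((?ls n)[n := L n], (?\<sigma> n)[n := None], e), (?ps n)[n := J n]) \<and> L n \<in> Loc"
      using n by (intro product_nfa_run_one[OF assms(1)[OF n] IH(2)]) auto
    moreover from this have "((?ls n)[n := L n], (?\<sigma> n)[n := None], e) \<in> controls"
      using n IH(2) by (intro controls_update[where cs = "opt_list (\<sigma> ! n)"]) auto
    ultimately show ?case
      unfolding upds using IH(1) by (meson rtranclp_trans)
  qed
  have eqs: "?ls K = map L [0..<K]" "?\<sigma> K = replicate K None" "?ps K = map J [0..<K]"
    by (auto intro!: nth_equalityI)
  show ?thesis
    using *[OF order_refl] unfolding eqs .
qed

text \<open>Induction on the rounds: \<open>reads_split\<close> cuts every run where the last round
  begins, which yields the states \<open>M\<close> and positions \<open>I\<close> to which the
  induction hypothesis applies.\<close>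

lemma product_nfa_complete:
  assumes "admissible w e" and "\<And>p. p < K \<Longrightarrow> reads p x l0 0 (track p w) (L p) (J p)"
  shows "(nfa_step product_nfa x)\<^sup>*\<^sup>* (nstart product_nfa, replicate K 0)
           ((map L [0..<K], replicate K None, e), map J [0..<K])
     \<and> (map L [0..<K], replicate K None, e) \<in> controls"
  using assms
proof (induction arbitrary: L J rule: admissible.induct)
  case admissible_Nil
  have "(map (\<lambda>_. l0) [0..<K], replicate K None, e0) \<in> controls"
    using is_oneway_product_nfa by (simp add: is_oneway_nfa_def product_nfa_def map_replicate_trivial)
  then show ?case
    using product_nfa_run_all[of x "\<lambda>_. l0" "\<lambda>_. 0" "replicate K None" L J e0] admissible_Nil
    by (simp add: product_nfa_def map_replicate_trivial)
next
  case (admissible_snoc w e \<sigma>)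
  have "\<forall>p\<in>{..<K}. \<exists>m j. reads p x l0 0 (track p w) m j \<and> reads p x m j (opt_list (\<sigma> ! p)) (L p) (J p)"
    using admissible_snoc.prems reads_split by fastforce
  then obtain M I where mid: "\<And>p. p < K \<Longrightarrow> reads p x l0 0 (track p w) (M p) (I p)"
      "\<And>p. p < K \<Longrightarrow> reads p x (M p) (I p) (opt_list (\<sigma> ! p)) (L p) (J p)"
    by (metis lessThan_iff)
  have 1: "(nfa_step product_nfa x)\<^sup>*\<^sup>* (nstart product_nfa, replicate K 0)
       ((map M [0..<K], replicate K None, e), map I [0..<K])"
     "(map M [0..<K], replicate K None, e) \<in> controls"
    using admissible_snoc.IH[OF mid(1)] by auto
  have "((map M [0..<K], replicate K None, e), map (input_tape x) (map I [0..<K]),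
      (map M [0..<K], \<sigma>, upd e \<sigma>), replicate K False) \<in> moves"
    unfolding moves_def using 1(2) admissible_snoc.hyps
    by (intro UnI2 CollectI exI[of _ "map M [0..<K]"] exI[of _ \<sigma>] exI[of _ e]
        exI[of _ "map (input_tape x) (map I [0..<K])"]) simp
  then have "nfa_step product_nfa x ((map M [0..<K], replicate K None, e), map I [0..<K])
      ((map M [0..<K], \<sigma>, upd e \<sigma>), map I [0..<K])"
    unfolding nfa_step_def product_nfa_def
    using map2_move_none[of "map I [0..<K]" K]
    by (intro exI[of _ "replicate K False"]) simp
  moreover have "(map M [0..<K], \<sigma>, upd e \<sigma>) \<in> controls"
    using 1(2) admissible_snoc.hyps upd by (auto simp: controls_def)
  ultimately show ?case
    using product_nfa_run_all[OF mid(2), where e = "upd e \<sigma>"] 1(1)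
    by (meson rtranclp.rtrancl_into_rtrancl rtranclp_trans)
qed

text \<open>The form in which the product is applied. A final control state may occur in the middle
  of a round, so soundness has to cope with machines that have read only a prefix of their
  track.\<close>

lemma letter_rounds_in_oneNFA:
  assumes sound: "\<And>x w e ls. admissible w e \<Longrightarrow> length ls = K \<Longrightarrow> F ls
      \<Longrightarrow> (\<And>p. p < K \<Longrightarrow> \<exists>cs ds i. reads p x l0 0 cs (ls ! p) i \<and> track p w = cs @ ds) \<Longrightarrow> x \<in> A"
    and complete: "\<And>x. x \<in> A \<Longrightarrow> \<exists>w e L J. admissible w e \<and> F (map L [0..<K]) \<and>
      (\<forall>p<K. reads p x l0 0 (track p w) (L p) (J p))"
  shows "A \<in> oneNFA K"
proof -
  have "x \<in> A" if "x \<in> nfa_language K product_nfa" for x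
  proof -
    obtain ls \<sigma> e ps where r: "(nfa_step product_nfa x)\<^sup>*\<^sup>* (nstart product_nfa, replicate K 0) ((ls, \<sigma>, e), ps)"
        and f: "(ls, \<sigma>, e) \<in> controls" "F ls"
      using \<open>x \<in> nfa_language K product_nfa\<close> by (auto simp: nfa_language_def) (auto simp: product_nfa_def)
    from product_nfa_sound[OF r] obtain w where "admissible w e"
        "\<forall>p<K. \<exists>cs. reads p x l0 0 cs (ls ! p) (ps ! p) \<and> track p w = cs @ opt_list (\<sigma> ! p)"
      by auto
    then show ?thesis
      using f by (intro sound[of w e ls x]) (auto simp: controls_def, blast)
  qed
  moreover have "x \<in> nfa_language K product_nfa" if "x \<in> A" for x
  proof -
    obtain w e L J where "admissible w e" "F (map L [0..<K])"
        "\<forall>p<K. reads p x l0 0 (track p w) (L p) (J p)"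
      using complete[OF \<open>x \<in> A\<close>] by blast
    then show ?thesis
      using product_nfa_complete[of w e x L J]
      by (auto simp: nfa_language_def) (auto simp: product_nfa_def)
  qed
  ultimately have "A = nfa_language K product_nfa"
    by blast
  then show ?thesis
    using nfa_language_in_oneNFA[OF is_oneway_product_nfa] by simp
qed

end

section \<open>From verifiers to automata\<close>

text \<open>A walk with steps of length at most 1 visits every position between its start and its
  current place, so few visited cells keep it near the start. The one-sided bound is applied to
  \<open>f\<close> and to its negative.\<close>

lemma abs_bound_of_card_image:
  fixes f :: "nat \<Rightarrow> int"
  assumes "f 0 = 0" and step: "\<And>i. \<bar>f (Suc i) - f i\<bar> \<le> 1" and card: "card (f ` {..t}) \<le> s"
  shows "\<bar>f t\<bar> \<le> int s"
proof -
  have pos: "g t \<le> int s"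
    if g: "g 0 = 0" "\<And>i. \<bar>g (Suc i) - g i\<bar> \<le> 1" "card (g ` {..t}) \<le> s" for g :: "nat \<Rightarrow> int"
  proof -
    have "{0..g t} \<subseteq> g ` {..t}"
    proof
      fix k assume "k \<in> {0..g t}"
      then have "\<exists>i\<le>t. g i = k"
        using g by (intro nat0_intermed_int_val) auto
      then show "k \<in> g ` {..t}" by auto
    qed
    then have "card {0..g t} \<le> s"
      using g(3) card_mono[of "g ` {..t}" "{0..g t}"] by simp
    then show ?thesis by simp
  qed
  have "card ((\<lambda>i. - f i) ` {..t}) = card (f ` {..t})"
    using card_image[of uminus "f ` {..t}"] by (simp add: image_image inj_on_def)
  moreover have "\<bar>- f (Suc i) - - f i\<bar> \<le> 1" for i
    using step[of i] by linarith
  ultimately show ?thesis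
    using pos[of f] pos[of "\<lambda>i. - f i"] assms by simp
qed

lemma is_verifier_sets:
  assumes "is_verifier V"
  shows "finite (vstates V) \<and> finite (vwork V) \<and> finite (vcomm V) \<and> vstart V \<in> vstates V \<and>
     vaccept V \<noteq> vreject V \<and> vblank V \<in> vwork V \<and> vnull V \<in> vcomm V"
  using assms unfolding is_verifier_def by (elim conjE) (intro conjI; assumption)

lemma is_verifierD:
  assumes "is_verifier V" "q \<in> vstates V" "w \<in> vwork V" "g \<in> vcomm V"
    and "vdelta V q a w g b = (q', w', m, di, dw)"
  shows "q' \<in> vstates V" "w' \<in> vwork V" "m \<in> vcomm V"
    "a = LeftEnd \<Longrightarrow> di \<noteq> GoLeft" "a = RightEnd \<Longrightarrow> di \<noteq> GoRight"
proof -
  have "\<forall>q\<in>vstates V. \<forall>a. \<forall>w\<in>vwork V. \<forall>g\<in>vcomm V. \<forall>b.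
        case vdelta V q a w g b of (q', w', g', di, dw) \<Rightarrow>
          q' \<in> vstates V \<and> w' \<in> vwork V \<and> g' \<in> vcomm V \<and>
          (a = LeftEnd \<longrightarrow> di \<noteq> GoLeft) \<and> (a = RightEnd \<longrightarrow> di \<noteq> GoRight)"
    using assms(1) unfolding is_verifier_def by (elim conjE)
  from this[rule_format, OF assms(2,3,4), of a b]
  have "q' \<in> vstates V \<and> w' \<in> vwork V \<and> m \<in> vcomm V \<and>
      (a = LeftEnd \<longrightarrow> di \<noteq> GoLeft) \<and> (a = RightEnd \<longrightarrow> di \<noteq> GoRight)"
    unfolding assms(5) prod.case .
  then show "q' \<in> vstates V" "w' \<in> vwork V" "m \<in> vcomm V"
    "a = LeftEnd \<Longrightarrow> di \<noteq> GoLeft" "a = RightEnd \<Longrightarrow> di \<noteq> GoRight"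
    by blast+
qed

section \<open>The finite control of a resource-bounded verifier\<close>

locale bounded_verifier =
  fixes V :: "('a, 'q, 'w, 'g) verifier" and ow :: bool and Ps :: "('a, 'g) prover set"
    and s r :: nat
  assumes V: "is_verifier V"
    and Ps: "Ps = (if ow then oneway_provers V else provers V)"
    and space: "P \<in> Ps \<Longrightarrow> card ((\<lambda>i. cwpos (run V P x \<omega> i)) ` {..t}) \<le> s"
    and tosses: "P \<in> Ps \<Longrightarrow> ctosses (run V P x \<omega> t) \<le> r"
    and input: "P \<in> Ps \<Longrightarrow> cipos (run V P x \<omega> t) \<le> cipos (run V P x \<omega> (Suc t))"
begin

text \<open>Tape contents are functions on all integers; forcing blanks outside a window of radius
  \<open>s\<close> leaves finitely many of them.\<close>

definition tapes :: "(int \<Rightarrow> 'w) set" where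
  "tapes = {f. \<forall>i. (i \<in> {- int s..int s} \<longrightarrow> f i \<in> vwork V) \<and> (i \<notin> {- int s..int s} \<longrightarrow> f i = vblank V)}"

definition locals :: "('q \<times> int \<times> (int \<Rightarrow> 'w) \<times> 'g \<times> nat) set" where
  "locals = vstates V \<times> {- int s..int s} \<times> tapes \<times> vcomm V \<times> {..r}"

definition local0 :: "'q \<times> int \<times> (int \<Rightarrow> 'w) \<times> 'g \<times> nat" where
  "local0 = (vstart V, 0, (\<lambda>_. vblank V), vnull V, 0)"

definition local_of :: "('q, 'w, 'g) config \<Rightarrow> 'q \<times> int \<times> (int \<Rightarrow> 'w) \<times> 'g \<times> nat" where
  "local_of C = (cstate C, cwpos C, cwork C, ccell C, ctosses C)"

text \<open>A letter is a message together with the reply to it.\<close>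

inductive vstep ::
  "nat \<Rightarrow> 'q \<times> int \<times> (int \<Rightarrow> 'w) \<times> 'g \<times> nat \<Rightarrow> 'a tape_symbol \<Rightarrow> ('g \<times> 'g) list
    \<Rightarrow> 'q \<times> int \<times> (int \<Rightarrow> 'w) \<times> 'g \<times> nat \<Rightarrow> bool \<Rightarrow> bool"
where
  vstep_intro:
  "(q, wp, wk, g, n) \<in> locals \<Longrightarrow> l' \<in> locals \<Longrightarrow> q \<noteq> vaccept V \<Longrightarrow> q \<noteq> vreject V \<Longrightarrow>
   vdelta V q a (wk wp) g (if q \<in> vcoin V then Some (coins r p ! n) else None) = (q', w', m, di, dw) \<Longrightarrow>
   di \<noteq> GoLeft \<Longrightarrow>
   l' = (q', move_work dw wp, wk(wp := w'), g', if q \<in> vcoin V then n + 1 else n) \<Longrightarrow>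
   (if m = vnull V then g' = vnull V \<and> cs = [] else cs = [(m, g')]) \<Longrightarrow>
   vstep p (q, wp, wk, g, n) a cs l' (di = GoRight)"

text \<open>\<open>(p, p') \<in> E\<close> means that both machines got a letter in every round so
  far and share their history; thus \<open>(p, p) \<in> E\<close> says that \<open>p\<close> has
  never skipped a round. Only such machines may get a letter, which ties the \<open>n\<close>-th
  exchange to the \<open>n\<close>-th round. The second clause is the condition for a single prover
  to give all these replies.\<close>

definition ok_offer :: "(nat \<times> nat) set \<Rightarrow> ('g \<times> 'g) option list \<Rightarrow> bool" where
  "ok_offer E \<sigma> \<longleftrightarrow> (\<forall>p<2 ^ r. \<sigma> ! p \<noteq> None \<longrightarrow> (p, p) \<in> E) \<and>
     (\<forall>p<2 ^ r. \<forall>p'<2 ^ r. \<forall>m m' g g'. \<sigma> ! p = Some (m, g) \<longrightarrow> \<sigma> ! p' = Some (m', g') \<longrightarrow>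
        ow \<or> (m = m' \<and> (p, p') \<in> E) \<longrightarrow> g = g')"

text \<open>A machine that skips a round drops out for good, even from the diagonal.\<close>

definition refine_histories :: "(nat \<times> nat) set \<Rightarrow> ('g \<times> 'g) option list \<Rightarrow> (nat \<times> nat) set" where
  "refine_histories E \<sigma> = {(p, p') \<in> E. \<sigma> ! p = \<sigma> ! p' \<and> \<sigma> ! p \<noteq> None}"

definition majority :: "('q \<times> int \<times> (int \<Rightarrow> 'w) \<times> 'g \<times> nat) list \<Rightarrow> bool" where
  "majority ls \<longleftrightarrow> 2 ^ r < 2 * card {p. p < 2 ^ r \<and> fst (ls ! p) = vaccept V}"

lemma local0: "local0 \<in> locals"
  using is_verifier_sets[OF V] by (auto simp: local0_def locals_def tapes_def)

lemma finite_locals: "finite locals"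
proof -
  have "finite tapes"
    unfolding tapes_def by (rule finite_set_of_finite_funs) (use is_verifier_sets[OF V] in auto)
  then show ?thesis
    using is_verifier_sets[OF V] by (simp add: locals_def)
qed

sublocale letter_rounds "2 ^ r" locals local0 vstep "vcomm V \<times> vcomm V" "Pow ({..<2 ^ r} \<times> {..<2 ^ r})"
    "{..<2 ^ r} \<times> {..<2 ^ r}" ok_offer refine_histories majority
proof unfold_locales
  fix p l a cs l' mv
  assume "vstep p l a cs l' mv"
  then show "l' \<in> locals \<and> length cs \<le> 1 \<and> (a = RightEnd \<longrightarrow> \<not> mv)"
  proof cases
    case (vstep_intro q wp wk g n q' w' m di dw g')
    have "q \<in> vstates V" "g \<in> vcomm V" "wk wp \<in> vwork V"
      using vstep_intro(3) by (auto simp: locals_def tapes_def)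
    then have "a = RightEnd \<Longrightarrow> di \<noteq> GoRight"
      using is_verifierD(5)[OF V _ _ _ vstep_intro(7)] by simp
    then show ?thesis
      using vstep_intro by (auto split: if_splits)
  qed
qed (use is_verifier_sets[OF V] finite_locals local0 in \<open>auto simp: refine_histories_def\<close>)

section \<open>Runs of the verifier as letter sequences\<close>

lemma provers_of_Ps: "P \<in> Ps \<Longrightarrow> P x h m \<in> vcomm V"
  by (auto simp: Ps oneway_provers_def provers_def split: if_splits)

lemma run_step_cases:
  assumes "C = run V P x \<omega> t"
  obtains (halted) "cstate C = vaccept V \<or> cstate C = vreject V" "run V P x \<omega> (Suc t) = C"
  | (moves) q' w' m di dw where "cstate C \<noteq> vaccept V" "cstate C \<noteq> vreject V"
      "vdelta V (cstate C) (input_tape x (cipos C)) (cwork C (cwpos C)) (ccell C)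
         (if cstate C \<in> vcoin V then Some (\<omega> (ctosses C)) else None) = (q', w', m, di, dw)"
      "run V P x \<omega> (Suc t) =
         \<lparr>cstate = q', cipos = move_input di (cipos C), cwpos = move_work dw (cwpos C),
          cwork = (cwork C)(cwpos C := w'),
          ccell = (if m = vnull V then vnull V else P x (chist C) m),
          ctosses = (if cstate C \<in> vcoin V then ctosses C + 1 else ctosses C),
          chist = (if m = vnull V then chist C else chist C @ [(m, P x (chist C) m)])\<rparr>"
proof (cases "cstate C = vaccept V \<or> cstate C = vreject V")
  case True
  then show ?thesis
    using assms by (intro halted) (simp_all add: run_Suc step_def)
next
  case False
  obtain q' w' m di dw where d: "vdelta V (cstate C) (input_tape x (cipos C)) (cwork C (cwpos C)) (ccell C)
         (if cstate C \<in> vcoin V then Some (\<omega> (ctosses C)) else None) = (q', w', m, di, dw)"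
    by (metis surj_pair)
  have "run V P x \<omega> (Suc t) = step V P x \<omega> C"
    by (simp add: run_Suc assms)
  then show ?thesis
    using False
    by (intro moves[OF _ _ d]) (simp_all only: step_def Let_def d prod.case if_False de_Morgan_disj simp_thms)
qed

lemma cwpos_bound:
  assumes "P \<in> Ps"
  shows "\<bar>cwpos (run V P x \<omega> t)\<bar> \<le> int s"
proof (rule abs_bound_of_card_image)
  show "cwpos (run V P x \<omega> 0) = 0"
    by (simp add: run_0 init_config_def)
  show "\<bar>cwpos (run V P x \<omega> (Suc i)) - cwpos (run V P x \<omega> i)\<bar> \<le> 1" for i
  proof -
    define C where "C = run V P x \<omega> i"
    from C_def show ?thesis
    proof (cases rule: run_step_cases)
      case halted
      then show ?thesis by (simp add: C_def)
    next
      case (moves q' w' m di dw)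
      then show ?thesis by (cases dw) (simp_all add: C_def)
    qed
  qed
qed (rule space[OF assms])

text \<open>The exchanges in the history are the letters read by machine \<open>p\<close>. The
  resource bounds keep every local state inside the finite set \<open>locals\<close>.\<close>

lemma reads_of_run:
  assumes P: "P \<in> Ps"
  shows "local_of (run V P x ((!) (coins r p)) t) \<in> locals \<and>
    reads p x local0 0 (chist (run V P x ((!) (coins r p)) t))
      (local_of (run V P x ((!) (coins r p)) t)) (cipos (run V P x ((!) (coins r p)) t))"
proof (induction t)
  case 0
  have "local_of (init_config V) = local0"
    by (simp add: local_of_def init_config_def local0_def)
  then show ?case
    using local0 by (simp add: run_0 reads_Nil) (simp add: init_config_def reads_Nil)
next
  case (Suc t)
  let ?\<omega> = "(!) (coins r p)"
  define C where "C = run V P x ?\<omega> t"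
  define D where "D = run V P x ?\<omega> (Suc t)"
  have IH: "local_of C \<in> locals" "reads p x local0 0 (chist C) (local_of C) (cipos C)"
    using Suc by (simp_all add: C_def)
  from C_def have "local_of D \<in> locals \<and> reads p x local0 0 (chist D) (local_of D) (cipos D)"
  proof (cases rule: run_step_cases)
    case halted
    then show ?thesis using IH by (simp add: D_def)
  next
    case (moves q' w' m di dw)
    have D: "D = \<lparr>cstate = q', cipos = move_input di (cipos C), cwpos = move_work dw (cwpos C),
          cwork = (cwork C)(cwpos C := w'),
          ccell = (if m = vnull V then vnull V else P x (chist C) m),
          ctosses = (if cstate C \<in> vcoin V then ctosses C + 1 else ctosses C),
          chist = (if m = vnull V then chist C else chist C @ [(m, P x (chist C) m)])\<rparr>"
      using moves(4) by (simp add: D_def)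
    have mem: "cstate C \<in> vstates V" "cwpos C \<in> {- int s..int s}" "cwork C \<in> tapes"
        "ccell C \<in> vcomm V"
      using IH(1) by (auto simp: locals_def local_of_def)
    then have "cwork C (cwpos C) \<in> vwork V"
      by (auto simp: tapes_def)
    note vD = is_verifierD[OF V mem(1) this mem(4) moves(3)]
    have "vnull V \<in> vcomm V"
      using is_verifier_sets[OF V] by blast
    moreover have "cwpos D \<in> {- int s..int s}" "ctosses D \<le> r"
      using cwpos_bound[OF P, of x ?\<omega> "Suc t"] tosses[OF P, of x ?\<omega> "Suc t"]
      by (simp_all add: D_def abs_le_iff minus_le_iff)
    moreover have "cwork D \<in> tapes"
      using mem(2,3) vD(2) by (auto simp: D tapes_def)
    ultimately have locD: "local_of D \<in> locals"
      using vD(1) provers_of_Ps[OF P] by (auto simp: local_of_def locals_def D)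
    \<comment> \<open>One-wayness permits a left move only at position 0, where subtraction on
      natural numbers leaves the position unchanged; there the left end-marker forbids the
      move.\<close>
    have "di \<noteq> GoLeft"
    proof
      assume di: "di = GoLeft"
      then have "cipos C = 0"
        using input[OF P, of x ?\<omega> t] moves(4) by (simp add: C_def[symmetric])
      then show False
        using vD(4) di by (simp add: input_tape_def)
    qed
    then have "vstep p (local_of C) (input_tape x (cipos C))
        (if m = vnull V then [] else [(m, P x (chist C) m)]) (local_of D) (di = GoRight)"
      unfolding local_of_def
      using IH(1) locD moves(1-3)
      by (intro vstep_intro[where g' = "ccell D" and q' = q' and w' = w' and dw = dw and m = m])
        (simp_all add: local_of_def D)
    from reads_step[OF IH(2) this]
    have "reads p x local0 0 (chist D) (local_of D) (if di = GoRight then cipos C + 1 else cipos C)"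
      by (simp add: D split: if_splits)
    moreover have "cipos D = (if di = GoRight then cipos C + 1 else cipos C)"
      using \<open>di \<noteq> GoLeft\<close> by (cases di) (simp_all add: D)
    ultimately show ?thesis
      using locD by simp
  qed
  then show ?case by (simp add: D_def)
qed

section \<open>Guessed replies and the existence of a prover\<close>

definition replies :: "('a, 'g) prover \<Rightarrow> 'a list \<Rightarrow> ('g \<times> 'g) list \<Rightarrow> bool" where
  "replies P x h \<longleftrightarrow> (\<forall>j<length h. snd (h ! j) = P x (take j h) (fst (h ! j)))"

lemma replies_snoc: "replies P x (h @ [(m, g)]) \<longleftrightarrow> replies P x h \<and> g = P x h m"
proof
  assume *: "replies P x (h @ [(m, g)])"
  have "snd (h ! j) = P x (take j h) (fst (h ! j))" if "j < length h" for j
    using *[unfolded replies_def, rule_format, of j] that by (simp add: nth_append)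
  then show "replies P x h \<and> g = P x h m"
    using *[unfolded replies_def, rule_format, of "length h"] by (simp add: replies_def)
next
  assume "replies P x h \<and> g = P x h m"
  then show "replies P x (h @ [(m, g)])"
    by (auto simp: replies_def nth_append less_Suc_eq)
qed

lemma chist_run:
  assumes P: "P \<in> Ps"
  shows "replies P x (chist (run V P x ((!) (coins r p)) t)) \<and>
    set (chist (run V P x ((!) (coins r p)) t)) \<subseteq> vcomm V \<times> vcomm V"
proof (induction t)
  case 0
  show ?case by (simp add: run_0 init_config_def replies_def)
next
  case (Suc t)
  define C where "C = run V P x ((!) (coins r p)) t"
  have loc: "local_of C \<in> locals"
    unfolding C_def using reads_of_run[OF P] by blast
  have IH: "replies P x (chist C)" "set (chist C) \<subseteq> vcomm V \<times> vcomm V"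
    using Suc by (simp_all add: C_def)
  from C_def show ?case
  proof (cases rule: run_step_cases)
    case halted
    then show ?thesis using IH by simp
  next
    case (moves q' w' m di dw)
    have "cstate C \<in> vstates V" "cwork C (cwpos C) \<in> vwork V" "ccell C \<in> vcomm V"
      using loc by (auto simp: locals_def local_of_def tapes_def)
    from is_verifierD(3)[OF V this moves(3)] have "m \<in> vcomm V" .
    then show ?thesis
      using IH provers_of_Ps[OF P] by (auto simp: moves(4) replies_snoc)
  qed
qed

text \<open>Converse of \<open>reads_of_run\<close>: a letter contains a guessed reply, and once all
  guesses agree with \<open>P\<close>, each step of the machine is a step of the verifier
  interacting with \<open>P\<close>.\<close>

lemma run_of_reads:
  assumes "reads p x local0 0 cs l i" and "replies P x cs"
  shows "\<exists>t. local_of (run V P x ((!) (coins r p)) t) = l \<and>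
    cipos (run V P x ((!) (coins r p)) t) = i \<and> chist (run V P x ((!) (coins r p)) t) = cs"
  using assms
proof (induction rule: reads.induct)
  case reads_Nil
  show ?case
    by (intro exI[of _ 0]) (simp add: run_0 local_of_def init_config_def local0_def)
next
  case (reads_step cs l' i' c l'' mv)
  let ?\<omega> = "(!) (coins r p)"
  from reads_step.hyps(2) show ?case
  proof cases
    case (vstep_intro q wp wk g n q' w' m di dw g')
    have "replies P x cs"
      using reads_step.prems vstep_intro(10) by (auto simp: replies_snoc split: if_splits)
    then obtain t where t: "local_of (run V P x ?\<omega> t) = l'" "cipos (run V P x ?\<omega> t) = i'"
        "chist (run V P x ?\<omega> t) = cs"
      using reads_step.IH by blast
    have g': "m \<noteq> vnull V \<Longrightarrow> g' = P x cs m"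
      using reads_step.prems vstep_intro(10) by (simp add: replies_snoc)
    have c: "cstate (run V P x ?\<omega> t) = q" "cwpos (run V P x ?\<omega> t) = wp"
        "cwork (run V P x ?\<omega> t) = wk" "ccell (run V P x ?\<omega> t) = g" "ctosses (run V P x ?\<omega> t) = n"
      using t(1) vstep_intro(1) by (simp_all add: local_of_def)
    have "move_input di i' = (if mv then i' + 1 else i')"
      using vstep_intro(2,8) by (cases di) simp_all
    then show ?thesis
      using vstep_intro g'
      by (intro exI[of _ "Suc t"]) (auto simp: run_Suc step_def Let_def c t local_of_def)
  qed
qed

text \<open>The middle claim identifies the controller state. The last one is what a prover needs:
  equal messages after equal histories get equal replies, and with one-way communication all
  \<open>j\<close>-th replies coincide.\<close>

lemma admissible_invariant:
  assumes "admissible w E"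
  shows "(\<forall>p<2 ^ r. length (track p w) \<le> length w \<and> set (track p w) \<subseteq> vcomm V \<times> vcomm V) \<and>
    E = {(p, p'). p < 2 ^ r \<and> p' < 2 ^ r \<and> length (track p w) = length w \<and> track p w = track p' w} \<and>
    (\<forall>p<2 ^ r. \<forall>p'<2 ^ r. \<forall>j m g m' g'. j < length (track p w) \<longrightarrow> j < length (track p' w) \<longrightarrow>
       track p w ! j = (m, g) \<longrightarrow> track p' w ! j = (m', g') \<longrightarrow>
       ow \<or> (m = m' \<and> take j (track p w) = take j (track p' w)) \<longrightarrow> g = g')"
  (is "?A w \<and> ?B w E \<and> ?C w")
  using assms
proof (induction rule: admissible.induct)
  case admissible_Nil
  show ?case by auto
next
  case (admissible_snoc w E \<sigma>)
  note IH = admissible_snoc.IH[THEN conjunct1]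
    admissible_snoc.IH[THEN conjunct2, THEN conjunct1]
    admissible_snoc.IH[THEN conjunct2, THEN conjunct2]
  have A: "length (track p w) \<le> length w" "set (track p w) \<subseteq> vcomm V \<times> vcomm V" if "p < 2 ^ r" for p
    using IH(1) that by blast+
  have B: "(p, p') \<in> E \<longleftrightarrow> p < 2 ^ r \<and> p' < 2 ^ r \<and> length (track p w) = length w \<and> track p w = track p' w" for p p'
    unfolding IH(2) by simp
  have live: "length (track p w) = length w" if "p < 2 ^ r" "\<sigma> ! p \<noteq> None" for p
    using admissible_snoc.hyps(3) that B[of p p] by (auto simp: ok_offer_def)
  have letter: "set (opt_list (\<sigma> ! p)) \<subseteq> vcomm V \<times> vcomm V" if "p < 2 ^ r" for p
  proof -
    have "\<sigma> ! p \<in> insert None (Some ` (vcomm V \<times> vcomm V))"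
      using admissible_snoc.hyps(2) that nth_mem[of p \<sigma>] by (auto simp only: offers_def mem_Collect_eq subset_iff)
    then show ?thesis by auto
  qed
  have "?A (w @ [\<sigma>])"
  proof (intro allI impI)
    fix p :: nat assume p: "p < 2 ^ r"
    show "length (track p (w @ [\<sigma>])) \<le> length (w @ [\<sigma>]) \<and> set (track p (w @ [\<sigma>])) \<subseteq> vcomm V \<times> vcomm V"
      using A[OF p] letter[OF p] by (cases "\<sigma> ! p") auto
  qed
  moreover have "?B (w @ [\<sigma>]) (refine_histories E \<sigma>)"
  proof (intro set_eqI)
    fix z :: "nat \<times> nat"
    obtain p p' where z: "z = (p, p')" by fastforce
    show "z \<in> refine_histories E \<sigma> \<longleftrightarrow> z \<in> {(p, p'). p < 2 ^ r \<and> p' < 2 ^ r \<and>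
        length (track p (w @ [\<sigma>])) = length (w @ [\<sigma>]) \<and> track p (w @ [\<sigma>]) = track p' (w @ [\<sigma>])}"
    proof (cases "p < 2 ^ r \<and> p' < 2 ^ r")
      case True
      then show ?thesis
        using B[of p p'] live[of p] live[of p'] A(1)[of p] A(1)[of p']
        by (cases "\<sigma> ! p"; cases "\<sigma> ! p'")
          (auto simp: z refine_histories_def dest: arg_cong[where f = length])
    next
      case False
      then show ?thesis
        using B[of p p'] by (auto simp: z refine_histories_def)
    qed
  qed
  moreover have "?C (w @ [\<sigma>])"
  proof (intro allI impI)
    fix p p' j m g m' g'
    assume p: "p < 2 ^ r" "p' < 2 ^ r"
      and j: "j < length (track p (w @ [\<sigma>]))" "j < length (track p' (w @ [\<sigma>]))"
      and nth: "track p (w @ [\<sigma>]) ! j = (m, g)" "track p' (w @ [\<sigma>]) ! j = (m', g')"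
      and eq: "ow \<or> m = m' \<and> take j (track p (w @ [\<sigma>])) = take j (track p' (w @ [\<sigma>]))"
    show "g = g'"
    \<comment> \<open>Letters of earlier rounds fall under the induction hypothesis. Otherwise
      \<open>j\<close> equals \<open>length w\<close>, both letters belong to the new round, and
      equality of the histories is membership in \<open>E\<close>, so \<open>ok_offer\<close>
      applies.\<close>
    proof (cases "j < length w")
      case True
      \<comment> \<open>A machine that gets a letter now has missed no round, and one that gets none
        keeps its track.\<close>
      have "j < length (track q w)" if "q < 2 ^ r" "j < length (track q (w @ [\<sigma>]))" for q
        using live[OF that(1)] True that(2) by (cases "\<sigma> ! q") auto
      then have "j < length (track p w)" "j < length (track p' w)"
        using p j by blast+
      moreover from this have "track p w ! j = (m, g)" "track p' w ! j = (m', g')"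
          "ow \<or> m = m' \<and> take j (track p w) = take j (track p' w)"
        using nth eq by (simp_all add: nth_append)
      ultimately show ?thesis
        by (rule IH(3)[rule_format, OF p])
    next
      case False
      have last: "\<sigma> ! q = Some c \<and> length (track q w) = length w \<and> j = length w"
        if "q < 2 ^ r" "j < length (track q (w @ [\<sigma>]))" "track q (w @ [\<sigma>]) ! j = c" for q c
        using False that A(1)[OF that(1)] live[OF that(1)] by (cases "\<sigma> ! q") (auto simp: nth_append)
      note 1 = last[OF p(1) j(1) nth(1)] and 2 = last[OF p(2) j(2) nth(2)]
      have "ow \<or> m = m' \<and> (p, p') \<in> E"
        using eq 1 2 B p by auto
      then show ?thesis
        using admissible_snoc.hyps(3)[unfolded ok_offer_def, THEN conjunct2, rule_format, OF p, of m g m' g'] 1 2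
        by blast
    qed
  qed
  ultimately show ?case by (intro conjI)
qed

text \<open>The prover looks its reply up in the tracks. The last claim of
  \<open>admissible_invariant\<close> makes the table \<open>R\<close> single-valued; where the
  table has no entry, any symbol will do.\<close>

lemma prover_of_admissible:
  assumes "admissible w E"
  shows "\<exists>P\<in>Ps. \<forall>x. \<forall>p<2 ^ r. replies P x (track p w)"
proof -
  define R where "R h m g \<longleftrightarrow> (\<exists>p<2 ^ r. \<exists>m'. length h < length (track p w) \<and>
      track p w ! length h = (m', g) \<and> (ow \<or> m' = m \<and> h = take (length h) (track p w)))" for h m g
  define P :: "('a, 'g) prover" where
    "P = (\<lambda>x h m. if \<exists>g. R h m g then SOME g. R h m g else vnull V)"
  note inv = admissible_invariant[OF assms, THEN conjunct1]
    admissible_invariant[OF assms, THEN conjunct2, THEN conjunct2]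
  have R_unique: "g = g'" if R1: "R h m g" and R2: "R h m g'" for h m g g'
  proof -
    obtain p m1 where 1: "p < 2 ^ r" "length h < length (track p w)"
        "track p w ! length h = (m1, g)" "ow \<or> m1 = m \<and> h = take (length h) (track p w)"
      using R1 unfolding R_def by blast
    obtain p' m2 where 2: "p' < 2 ^ r" "length h < length (track p' w)"
        "track p' w ! length h = (m2, g')" "ow \<or> m2 = m \<and> h = take (length h) (track p' w)"
      using R2 unfolding R_def by blast
    have "ow \<or> m1 = m2 \<and> take (length h) (track p w) = take (length h) (track p' w)"
      using 1(4) 2(4) by metis
    then show ?thesis
      by (rule inv(2)[rule_format, OF 1(1) 2(1) 1(2) 2(2) 1(3) 2(3)])
  qed
  have R_comm: "g \<in> vcomm V" if R: "R h m g" for h m g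
  proof -
    obtain p m' where p: "p < 2 ^ r" "length h < length (track p w)" "track p w ! length h = (m', g)"
      using R unfolding R_def by blast
    then have "(m', g) \<in> set (track p w)"
      by (auto simp: in_set_conv_nth)
    then show ?thesis using inv(1) p(1) by blast
  qed
  have "vnull V \<in> vcomm V"
    using is_verifier_sets[OF V] by blast
  then have "P \<in> provers V"
    unfolding provers_def P_def using R_comm by (auto intro: someI2)
  \<comment> \<open>With one-way communication the table depends on the length of the history only,
    so a dummy history of the right length defines the certificate.\<close>
  moreover have "\<exists>c. \<forall>x h m. P x h m = c x (length h)" if ow
  proof -
    have "R h m = R (replicate (length h) undefined) undefined" for h m
      using that by (simp add: R_def fun_eq_iff)
    then have "P x h m = P x (replicate (length h) undefined) undefined" for x h m
      unfolding P_def by (rule arg_cong)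
    then show ?thesis
      by (intro exI[of _ "\<lambda>x n. P x (replicate n undefined) undefined"] allI)
  qed
  ultimately have "P \<in> Ps"
    by (auto simp: Ps oneway_provers_def)
  moreover have "replies P x (track p w)" if "p < 2 ^ r" for x p
    unfolding replies_def
  proof (intro allI impI)
    fix j assume j: "j < length (track p w)"
    have "R (take j (track p w)) (fst (track p w ! j)) (snd (track p w ! j))"
      unfolding R_def using j that by (intro exI[of _ p]) (auto simp: min_def prod_eq_iff)
    then show "snd (track p w ! j) = P x (take j (track p w)) (fst (track p w ! j))"
      unfolding P_def using R_unique by (auto intro!: some_equality[symmetric])
  qed
  ultimately show ?thesis by blast
qed

text \<open>Round \<open>n\<close> offers each machine the \<open>n\<close>-th entry of its history,
  if there is one. This is allowed because one prover gave all the replies: they agree after equal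
  histories and messages, and in the one-way case after histories of equal length.\<close>

lemma admissible_of_prover:
  assumes P: "P \<in> Ps"
    and h: "\<And>p. p < 2 ^ r \<Longrightarrow> replies P x (h p) \<and> set (h p) \<subseteq> vcomm V \<times> vcomm V"
  shows "\<exists>w E. admissible w E \<and> (\<forall>p<2 ^ r. track p w = take n (h p)) \<and> length w = n"
proof (induction n)
  case 0
  show ?case using admissible_Nil by (intro exI[of _ "[]"]) auto
next
  case (Suc n)
  then obtain w E where w: "admissible w E" "\<And>p. p < 2 ^ r \<Longrightarrow> track p w = take n (h p)" "length w = n"
    by blast
  define \<sigma> where "\<sigma> = map (\<lambda>p. if n < length (h p) then Some (h p ! n) else None) [0..<2 ^ r]"
  have \<sigma>: "\<sigma> ! p = (if n < length (h p) then Some (h p ! n) else None)" if "p < 2 ^ r" for p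
    using that by (simp add: \<sigma>_def)
  have E: "(p, p') \<in> E \<longleftrightarrow> p < 2 ^ r \<and> p' < 2 ^ r \<and> length (track p w) = length w \<and> track p w = track p' w" for p p'
    unfolding admissible_invariant[OF w(1), THEN conjunct2, THEN conjunct1] by simp
  have "\<sigma> \<in> offers"
    using h unfolding offers_def \<sigma>_def by (fastforce dest: nth_mem)
  moreover have "ok_offer E \<sigma>"
    unfolding ok_offer_def
  proof (intro conjI allI impI)
    fix p :: nat assume "p < 2 ^ r" "\<sigma> ! p \<noteq> None"
    then show "(p, p) \<in> E"
      by (simp add: E \<sigma> w split: if_splits)
  next
    fix p p' m m' g g'
    assume p: "p < 2 ^ r" "p' < 2 ^ r" and l: "\<sigma> ! p = Some (m, g)" "\<sigma> ! p' = Some (m', g')"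
      and eq: "ow \<or> m = m' \<and> (p, p') \<in> E"
    have g: "n < length (h q) \<and> g = P x (take n (h q)) m" if "q < 2 ^ r" "\<sigma> ! q = Some (m, g)" for q m g
    proof -
      have "n < length (h q)" "h q ! n = (m, g)"
        using that by (auto simp: \<sigma> split: if_splits)
      moreover have "snd (h q ! n) = P x (take n (h q)) (fst (h q ! n))"
        using h[OF that(1)] calculation(1) by (simp add: replies_def)
      ultimately show ?thesis by simp
    qed
    note g1 = g[OF p(1) l(1)] and g2 = g[OF p(2) l(2)]
    show "g = g'"
    proof (cases ow)
      case True
      then obtain c where "\<And>x h m. P x h m = c x (length h)"
        using P by (auto simp: Ps oneway_provers_def)
      then show ?thesis
        using g1 g2 by (simp add: min_def)
    next
      case False
      then have "m = m'" "take n (h p) = take n (h p')"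
        using eq p by (auto simp: E w)
      then show ?thesis
        using g1 g2 by simp
    qed
  qed
  ultimately have "admissible (w @ [\<sigma>]) (refine_histories E \<sigma>)"
    using w(1) by (intro admissible_snoc)
  moreover have "track p (w @ [\<sigma>]) = take (Suc n) (h p)" if "p < 2 ^ r" for p
    using that by (simp add: w \<sigma> take_Suc_conv_app_nth)
  ultimately show ?case
    using w(3) by (intro exI[of _ "w @ [\<sigma>]"]) auto
qed

section \<open>Acceptance by a majority of the outcomes\<close>

lemma halting_states_exclusive:
  assumes "cstate (run V P x \<omega> t) = vaccept V"
  shows "cstate (run V P x \<omega> t') \<noteq> vreject V"
proof -
  have keep: "run V P x \<omega> (t + n) = run V P x \<omega> t"
    if "cstate (run V P x \<omega> t) = vaccept V \<or> cstate (run V P x \<omega> t) = vreject V" for t n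
    using that by (induction n) (simp_all add: run_Suc step_def)
  have "vaccept V \<noteq> vreject V"
    using is_verifier_sets[OF V] by blast
  then show ?thesis
    using keep[of t "t' - t"] keep[of t' "t - t'"] assms by (cases "t \<le> t'") auto
qed

definition accepting :: "('a, 'g) prover \<Rightarrow> 'a list \<Rightarrow> nat set" where
  "accepting P x = {p. p < 2 ^ r \<and> (\<exists>t. cstate (run V P x ((!) (coins r p)) t) = vaccept V)}"

lemma accept_prob_eq: "P \<in> Ps \<Longrightarrow> accept_prob V P x = card (accepting P x) / 2 ^ r"
  unfolding accept_prob_def accepting_def by (rule measure_run_state) (rule tosses)

text \<open>Only an inequality, since a run may go on forever.\<close>

lemma reject_prob_le:
  assumes "P \<in> Ps"
  shows "reject_prob V P x \<le> 1 - card (accepting P x) / 2 ^ r"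
proof -
  let ?R = "{p. p < 2 ^ r \<and> (\<exists>t. cstate (run V P x ((!) (coins r p)) t) = vreject V)}"
  have "card (accepting P x) + card ?R = card (accepting P x \<union> ?R)"
    using halting_states_exclusive by (intro card_Un_disjoint[symmetric]) (auto simp: accepting_def)
  also have "\<dots> \<le> card {..<2 ^ r :: nat}"
    by (intro card_mono) (auto simp: accepting_def)
  finally have "real (card (accepting P x) + card ?R) \<le> real (2 ^ r)"
    by (simp only: of_nat_le_iff card_lessThan)
  then have "real (card (accepting P x) + card ?R) \<le> 2 ^ r"
    by simp
  moreover have "reject_prob V P x = card ?R / 2 ^ r"
    unfolding reject_prob_def by (rule measure_run_state) (rule tosses[OF assms])
  ultimately show ?thesis
    by (simp add: field_simps)
qed

lemma proof_system_in_oneNFA: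
  assumes L: "proof_system V Ps \<epsilon> L" and \<epsilon>: "\<epsilon> < 1 / 2"
  shows "L \<in> oneNFA (2 ^ r)"
proof (rule letter_rounds_in_oneNFA)
  fix x w E ls
  assume w: "admissible w E" and maj: "majority ls"
    and reads: "\<And>p. p < 2 ^ r \<Longrightarrow> \<exists>cs ds i. reads p x local0 0 cs (ls ! p) i \<and> track p w = cs @ ds"
  obtain P where P: "P \<in> Ps" "\<And>p. p < 2 ^ r \<Longrightarrow> replies P x (track p w)"
    using prover_of_admissible[OF w] by blast
  have "{p. p < 2 ^ r \<and> fst (ls ! p) = vaccept V} \<subseteq> accepting P x"
  proof
    fix p assume p: "p \<in> {p. p < 2 ^ r \<and> fst (ls ! p) = vaccept V}"
    then obtain cs ds i where r: "reads p x local0 0 cs (ls ! p) i" "track p w = cs @ ds"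
      using reads by blast
    have "replies P x cs"
      using P(2)[of p] p unfolding replies_def r(2) by (auto simp: nth_append split: if_splits)
    then obtain t where t: "local_of (run V P x ((!) (coins r p)) t) = ls ! p"
      using run_of_reads[OF r(1)] by blast
    then have "cstate (run V P x ((!) (coins r p)) t) = fst (ls ! p)"
      unfolding t[symmetric] by (simp add: local_of_def)
    then show "p \<in> accepting P x"
      using p by (auto simp: accepting_def)
  qed
  then have "card {p. p < 2 ^ r \<and> fst (ls ! p) = vaccept V} \<le> card (accepting P x)"
    by (intro card_mono) (auto simp: accepting_def)
  then have "2 ^ r < 2 * card (accepting P x)"
    using maj by (simp add: majority_def)
  then have "real (2 ^ r) < real (2 * card (accepting P x))"
    by (simp only: of_nat_less_iff)
  then have "1 / 2 < card (accepting P x) / 2 ^ r"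
    by (simp add: field_simps)
  \<comment> \<open>More than half of the outcomes accept, so rejection has probability below 1/2
    and hence below \<open>1 - \<epsilon>\<close>; for an input outside \<open>L\<close> this would
    contradict soundness.\<close>
  then have "reject_prob V P x < 1 - \<epsilon>"
    using reject_prob_le[OF P(1), of x] \<epsilon> by linarith
  then show "x \<in> L"
    using L P(1) by (force simp: proof_system_def)
next
  fix x assume x: "x \<in> L"
  obtain P where P: "P \<in> Ps" "accept_prob V P x \<ge> 1 - \<epsilon>"
    using L x by (auto simp: proof_system_def)
  \<comment> \<open>An outcome that never accepts gets an arbitrary time. Stopping its machine there
    is harmless, as \<open>majority\<close> counts only accepting machines.\<close>
  define T where "T p = (SOME t. cstate (run V P x ((!) (coins r p)) t) = vaccept V)" for p
  define C where "C p = run V P x ((!) (coins r p)) (T p)" for p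
  \<comment> \<open>Enough rounds to exhaust every history, so that \<open>take n\<close> cuts
    nothing off.\<close>
  define n where "n = Max ((\<lambda>p. length (chist (C p))) ` {..<2 ^ r})"
  have n: "length (chist (C p)) \<le> n" if "p < 2 ^ r" for p
    using that unfolding n_def by (intro Max_ge) auto
  obtain w E where w: "admissible w E" "\<And>p. p < 2 ^ r \<Longrightarrow> track p w = take n (chist (C p))"
    using admissible_of_prover[OF P(1), of x "\<lambda>p. chist (C p)" n] chist_run[OF P(1)] unfolding C_def by blast
  have "accepting P x \<subseteq> {p. p < 2 ^ r \<and> fst (map (\<lambda>p. local_of (C p)) [0..<2 ^ r] ! p) = vaccept V}"
    unfolding accepting_def C_def T_def by (auto simp: local_of_def intro: someI)
  then have "card (accepting P x)
      \<le> card {p. p < 2 ^ r \<and> fst (map (\<lambda>p. local_of (C p)) [0..<2 ^ r] ! p) = vaccept V}"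
    by (intro card_mono) auto
  moreover have "1 / 2 < card (accepting P x) / 2 ^ r"
    using P(2) \<epsilon> accept_prob_eq[OF P(1), of x] by linarith
  then have "real (2 ^ r) < real (2 * card (accepting P x))"
    by (simp add: field_simps)
  then have "2 ^ r < 2 * card (accepting P x)"
    by (simp only: of_nat_less_iff)
  ultimately have "majority (map (\<lambda>p. local_of (C p)) [0..<2 ^ r])"
    by (simp add: majority_def)
  moreover have "reads p x local0 0 (track p w) (local_of (C p)) (cipos (C p))" if "p < 2 ^ r" for p
    using reads_of_run[OF P(1), of x p "T p"] w(2)[OF that] n[OF that] by (simp add: C_def)
  ultimately show "\<exists>w E L J. admissible w E \<and> majority (map L [0..<2 ^ r]) \<and>
      (\<forall>p<2 ^ r. reads p x local0 0 (track p w) (L p) (J p))"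
    using w(1)
    by (intro exI[of _ w] exI[of _ E] exI[of _ "\<lambda>p. local_of (C p)"] exI[of _ "\<lambda>p. cipos (C p)"]) simp
qed

end

lemma proof_system_in_Union_oneNFA:
  assumes ver: "is_verifier V" "\<epsilon> < 1 / 2" "proof_system V Ps \<epsilon> L"
    and Ps: "Ps = provers V \<or> Ps = oneway_provers V"
    and R: "\<forall>R\<in>{cons_space, cons_random_bits, oneway_input}. R V Ps"
  shows "L \<in> (\<Union>k\<in>{1..}. oneNFA k)"
proof -
  obtain s where s: "\<forall>P\<in>Ps. \<forall>x \<omega> t. card ((\<lambda>i. cwpos (run V P x \<omega> i)) ` {..t}) \<le> s"
    using R by (auto simp: cons_space_def)
  obtain r where r: "\<forall>P\<in>Ps. \<forall>x \<omega> t. ctosses (run V P x \<omega> t) \<le> r"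
    using R by (auto simp: cons_random_bits_def)
  have i: "\<forall>P\<in>Ps. \<forall>x \<omega> t. cipos (run V P x \<omega> t) \<le> cipos (run V P x \<omega> (Suc t))"
    using R by (auto simp: oneway_input_def)
  \<comment> \<open>The second argument is the flag for one-way communication. Should both prover
    classes coincide, the flag is false, in accordance with \<open>Ps = provers V\<close>.\<close>
  interpret bounded_verifier V "Ps \<noteq> provers V" Ps s r
    using ver(1) s r i Ps by unfold_locales auto
  have "L \<in> oneNFA (2 ^ r)"
    using ver(2,3) by (rule proof_system_in_oneNFA[rotated])
  then show ?thesis
    by auto
qed

section \<open>From automata to verifiers\<close>

datatype control = Toss "bool list" | Check nat nat nat | Accept | Reject

instance control :: countable
  by countable_datatype

locale head_checker =
  fixes k :: nat and M :: "('a::finite, nat) multihead_nfa"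
  assumes nfa: "is_oneway_nfa k M" and k: "k \<ge> 1"
begin

text \<open>The number of pairs of states bounds the size of each relation
  \<open>idle_trans as\<close>, hence the length of a shortest path in it.\<close>

definition patience :: nat where
  "patience = card (nstates M) * card (nstates M)"

definition num_trans :: nat where
  "num_trans = card (ntrans M)"

definition trans_of :: "nat \<Rightarrow> nat \<times> 'a tape_symbol list \<times> nat \<times> bool list" where
  "trans_of = (SOME h. bij_betw h {..<num_trans} (ntrans M))"

definition outcome :: "bool list \<Rightarrow> nat" where
  "outcome bs = (SOME p. p < 2 ^ (k + 1) \<and> coins (k + 1) p = bs)"

definition enter :: "nat \<Rightarrow> nat \<Rightarrow> nat \<Rightarrow> control" where
  "enter j q c = (if q \<in> nfinal M then Accept else Check j q c)"

text \<open>The \<open>2 ^ k + 1\<close> outcomes up to \<open>2 ^ k\<close> check a head, the other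
  \<open>2 ^ k - 1\<close> reject. Residues modulo \<open>k\<close> give every head at least two
  outcomes, because \<open>2 * k \<le> 2 ^ k\<close>.\<close>

definition first_check :: "nat \<Rightarrow> control" where
  "first_check p = (if p \<le> 2 ^ k then enter (p mod k) (nstart M) 0 else Reject)"

text \<open>A move of any head resets the counter, so its value does not depend on which head is
  being checked.\<close>

definition count_idle :: "bool list \<Rightarrow> nat \<Rightarrow> nat" where
  "count_idle ms c = (if True \<in> set ms then 0 else c + 1)"

text \<open>Of the scanned symbols only the \<open>j\<close>-th can be compared, as the verifier has
  a single head; the conditions on the transition number, the state and the idle counter are common
  to all \<open>j\<close>.\<close>

definition check :: "nat \<Rightarrow> nat \<Rightarrow> nat \<Rightarrow> 'a tape_symbol \<Rightarrow> nat \<Rightarrow> control \<times> bool" where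
  "check j q c a g =
     (case trans_of g of (q1, as, q', ms) \<Rightarrow>
        if g < num_trans \<and> q1 = q \<and> as ! j = a \<and> count_idle ms c \<le> patience
        then (enter j q' (count_idle ms c), ms ! j) else (Reject, False))"

text \<open>The message \<open>1\<close> asks for the next transition; \<open>0\<close> is the null symbol.\<close>

definition delta :: "control \<Rightarrow> 'a tape_symbol \<Rightarrow> nat \<Rightarrow> bool option
    \<Rightarrow> control \<times> nat \<times> direction" where
  "delta s a g b = (case s of
     Toss bs \<Rightarrow> (let bs' = bs @ [b = Some True] in
       if length bs' \<le> k then (Toss bs', 0, Stay) else (first_check (outcome bs'), 1, Stay))
   | Check j q c \<Rightarrow> (case check j q c a g of (s', mv) \<Rightarrow> (s', 1, if mv then GoRight else Stay))
   | _ \<Rightarrow> (Reject, 0, Stay))"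

definition ctrls :: "control set" where
  "ctrls = Toss ` {bs. length bs \<le> k} \<union>
     (\<lambda>(j, q, c). Check j q c) ` ({..<k} \<times> nstates M \<times> {..patience}) \<union> {Accept, Reject}"

text \<open>The bound \<open>num_trans + 1\<close> puts the message \<open>1\<close> into the
  alphabet even if there is no transition. A reply may be \<open>0\<close> and then names transition
  number 0, since only a symbol written by the verifier is tested for being null.\<close>

definition verif :: "('a, nat, nat, nat) verifier" where
  "verif = \<lparr>vstates = to_nat ` ctrls, vstart = to_nat (Toss []), vaccept = to_nat Accept,
     vreject = to_nat Reject, vcoin = to_nat ` Toss ` {bs. length bs \<le> k}, vwork = {0}, vblank = 0,
     vcomm = {..num_trans + 1}, vnull = 0,
     vdelta = (\<lambda>q a w g b. case delta (from_nat q) a g b of (s, m, di) \<Rightarrow> (to_nat s, 0, m, di, Stay))\<rparr>"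

section \<open>Well-formedness and resources of the verifier\<close>

lemma nfaD:
  assumes "(q, as, q', ms) \<in> ntrans M"
  shows "q \<in> nstates M" "q' \<in> nstates M" "length as = k" "length ms = k"
    "\<And>i. i < k \<Longrightarrow> as ! i = RightEnd \<Longrightarrow> \<not> ms ! i"
  using nfa assms unfolding is_oneway_nfa_def by blast+

lemma nfa_states: "finite (nstates M)" "nstart M \<in> nstates M"
  using nfa by (auto simp: is_oneway_nfa_def)

declare [[show_types, show_sorts]]
lemma finite_tape_symbols: "finite (UNIV :: 'a tape_symbol set)"
proof (rule finite_subset)
  have "x \<in> insert LeftEnd (insert RightEnd (range Sym))" for x :: "'a tape_symbol"
    by (cases x) auto
  then show "(UNIV :: 'a tape_symbol set) \<subseteq> insert LeftEnd (insert RightEnd (range Sym))"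
    by blast
  show "finite (insert LeftEnd (insert RightEnd (range (Sym :: 'a \<Rightarrow> _))))"
    by (intro finite.insertI finite_imageI finite)
qed

text \<open>\<open>is_oneway_nfa\<close> demands finitely many states only; finiteness of the
  alphabet \<open>'a\<close> bounds the transitions, which have to fit into the communication
  alphabet.\<close>

lemma finite_ntrans: "finite (ntrans M)"
proof (rule finite_subset)
  show "ntrans M \<subseteq> nstates M \<times> {as. set as \<subseteq> UNIV \<and> length as = k} \<times> nstates M \<times>
      {ms. set ms \<subseteq> UNIV \<and> length ms = k}"
    using nfaD by auto
  show "finite (nstates M \<times> {as :: 'a tape_symbol list. set as \<subseteq> UNIV \<and> length as = k} \<times> nstates M \<times>
      {ms :: bool list. set ms \<subseteq> UNIV \<and> length ms = k})"
    by (intro finite_cartesian_product nfa_states finite_lists_length_eq finite_tape_symbols finite_class.finite_UNIV)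
qed

lemma trans_of: "bij_betw trans_of {..<num_trans} (ntrans M)"
proof -
  have "\<exists>h. bij_betw h {..<num_trans} (ntrans M)"
    using ex_bij_betw_nat_finite[OF finite_ntrans] by (simp add: num_trans_def atLeast0LessThan)
  then show ?thesis
    unfolding trans_of_def by (rule someI_ex)
qed

lemma trans_of_mem: "g < num_trans \<Longrightarrow> trans_of g \<in> ntrans M"
  using trans_of by (auto simp: bij_betw_def)

lemma outcome_coins:
  assumes "p < 2 ^ (k + 1)"
  shows "outcome (coins (k + 1) p) = p"
  unfolding outcome_def
proof (rule some_equality)
  show "p < 2 ^ (k + 1) \<and> coins (k + 1) p = coins (k + 1) p"
    using assms by simp
  show "p' = p" if "p' < 2 ^ (k + 1) \<and> coins (k + 1) p' = coins (k + 1) p" for p'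
    using that assms bij_betw_coins[of "k + 1"] by (auto simp: bij_betw_def inj_on_def)
qed

lemma enter_ctrls: "j < k \<Longrightarrow> q \<in> nstates M \<Longrightarrow> c \<le> patience \<Longrightarrow> enter j q c \<in> ctrls"
  by (force simp: enter_def ctrls_def)

lemma first_check_ctrls: "first_check p \<in> ctrls"
  using enter_ctrls[of "p mod k" "nstart M" 0] nfa_states k
  by (auto simp: first_check_def ctrls_def)

lemma check_ctrls:
  assumes "j < k" "check j q c a g = (s, mv)"
  shows "s \<in> ctrls \<and> (a = RightEnd \<longrightarrow> \<not> mv)"
proof (cases "g < num_trans")
  case True
  obtain q1 as q' ms where t: "trans_of g = (q1, as, q', ms)"
    by (metis surj_pair)
  then have "(q1, as, q', ms) \<in> ntrans M"
    using trans_of_mem[OF True] by simp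
  from nfaD(2,5)[OF this] show ?thesis
    using assms enter_ctrls by (auto simp: check_def t ctrls_def split: if_splits)
next
  case False
  then show ?thesis
    using assms(2) by (auto simp: check_def ctrls_def split: prod.splits)
qed

lemma delta_ctrls:
  assumes "s \<in> ctrls" "delta s a g b = (s', m, di)"
  shows "s' \<in> ctrls" "m \<le> 1" "di \<noteq> GoLeft" "a = RightEnd \<Longrightarrow> di \<noteq> GoRight"
proof -
  have "s' \<in> ctrls \<and> m \<le> 1 \<and> di \<noteq> GoLeft \<and> (a = RightEnd \<longrightarrow> di \<noteq> GoRight)"
  proof (cases s)
    case (Toss bs)
    then show ?thesis
      using assms(2) first_check_ctrls
      by (auto simp: delta_def Let_def split: if_splits) (auto simp: ctrls_def)
  next
    case (Check j q c)
    obtain s1 mv where c: "check j q c a g = (s1, mv)"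
      by fastforce
    have "j < k"
      using assms(1) by (auto simp: Check ctrls_def)
    from check_ctrls[OF this c] show ?thesis
      using assms(2) by (auto simp: delta_def Check c split: if_splits)
  qed (use assms(2) in \<open>auto simp: delta_def ctrls_def\<close>)
  then show "s' \<in> ctrls" "m \<le> 1" "di \<noteq> GoLeft" "a = RightEnd \<Longrightarrow> di \<noteq> GoRight"
    by blast+
qed

lemma finite_ctrls: "finite ctrls"
proof -
  have "finite {bs :: bool list. length bs \<le> k}"
    using finite_lists_length_le[of "UNIV :: bool set" k] by simp
  then show ?thesis
    using nfa_states by (simp add: ctrls_def)
qed

lemma is_verifier_verif: "is_verifier verif"
proof -
  have closed: "case vdelta verif q a w g b of (q', w', g', di, dw) \<Rightarrow>
      q' \<in> vstates verif \<and> w' \<in> vwork verif \<and> g' \<in> vcomm verif \<and>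
      (a = LeftEnd \<longrightarrow> di \<noteq> GoLeft) \<and> (a = RightEnd \<longrightarrow> di \<noteq> GoRight)"
    if q: "q \<in> vstates verif" for q a w g b
  proof -
    obtain s where s: "s \<in> ctrls" "q = to_nat s"
      using q by (auto simp: verif_def)
    obtain s' m di where d: "delta s a g b = (s', m, di)"
      by (metis surj_pair)
    show ?thesis
      using delta_ctrls[OF s(1) d] by (auto simp: verif_def s(2) d)
  qed
  show ?thesis
    unfolding is_verifier_def
    using closed
    by (intro conjI ballI allI) (use finite_ctrls in \<open>auto simp: verif_def ctrls_def\<close>)
qed

text \<open>Only \<open>Toss\<close> states toss a coin, and the list stored in one has as many bits
  as coins were tossed. As it has at most \<open>k\<close> bits, the tosses are bounded.\<close>

lemma verif_invariant:
  "cwpos (run verif P x \<omega> t) = 0 \<and> ctosses (run verif P x \<omega> t) \<le> k + 1 \<and>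
   (\<exists>s\<in>ctrls. cstate (run verif P x \<omega> t) = to_nat s \<and> (\<forall>bs. s = Toss bs \<longrightarrow> length bs = ctosses (run verif P x \<omega> t))) \<and>
   cipos (run verif P x \<omega> t) \<le> cipos (run verif P x \<omega> (Suc t))"
proof -
  have step: "cwpos D = 0 \<and> ctosses D \<le> k + 1 \<and> cipos C \<le> cipos D \<and>
      (\<exists>s\<in>ctrls. cstate D = to_nat s \<and> (\<forall>bs. s = Toss bs \<longrightarrow> length bs = ctosses D))"
    if C: "cwpos C = 0" "ctosses C \<le> k + 1" "s \<in> ctrls" "cstate C = to_nat s"
      "\<And>bs. s = Toss bs \<Longrightarrow> length bs = ctosses C" and D: "D = step verif P x \<omega> C" for C D s
  proof (cases "s = Accept \<or> s = Reject")
    case True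
    then have "D = C"
      using C(4) by (auto simp: D step_def verif_def)
    then show ?thesis using C by auto
  next
    case False
    define b where "b = (if cstate C \<in> vcoin verif then Some (\<omega> (ctosses C)) else None)"
    obtain s' m di where d: "delta s (input_tape x (cipos C)) (ccell C) b = (s', m, di)"
      by (metis surj_pair)
    have vd: "vdelta verif (cstate C) (input_tape x (cipos C)) (cwork C (cwpos C)) (ccell C) b
        = (to_nat s', 0, m, di, Stay)"
      by (simp add: verif_def C(4) d)
    have nh: "\<not> (cstate C = vaccept verif \<or> cstate C = vreject verif)"
      using False by (simp add: verif_def C(4))
    have D1: "cstate D = to_nat s'" "cwpos D = cwpos C" "cipos D = move_input di (cipos C)"
        "ctosses D = (if cstate C \<in> vcoin verif then ctosses C + 1 else ctosses C)"
      unfolding D step_def Let_def b_def[symmetric] vd prod.case by (simp_all add: nh)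
    have "cipos C \<le> cipos D"
      using delta_ctrls(3)[OF C(3) d] D1(3) by (cases di) auto
    moreover have "ctosses D \<le> k + 1 \<and> (\<forall>bs. s' = Toss bs \<longrightarrow> length bs = ctosses D)"
    proof (cases s)
      case (Toss bs)
      then have "length bs \<le> k" "length bs = ctosses C"
        using C(3,5) by (auto simp: ctrls_def)
      moreover from this have "cstate C \<in> vcoin verif"
        using C(4) by (simp add: verif_def Toss)
      ultimately show ?thesis
        using d by (auto simp: D1 Toss delta_def Let_def first_check_def enter_def split: if_splits)
    next
      case (Check j q c)
      then have "cstate C \<notin> vcoin verif"
        using C(4) by (auto simp: verif_def)
      moreover have "s' \<noteq> Toss bs" for bs
        using d by (auto simp: delta_def Check check_def enter_def split: prod.splits if_splits)
      ultimately show ?thesis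
        using C(2) by (simp add: D1)
    qed (use False in auto)
    ultimately show ?thesis
      using C(1) D1(1,2) delta_ctrls(1)[OF C(3) d] by auto
  qed
  have "cwpos (run verif P x \<omega> t) = 0 \<and> ctosses (run verif P x \<omega> t) \<le> k + 1 \<and>
   (\<exists>s\<in>ctrls. cstate (run verif P x \<omega> t) = to_nat s \<and> (\<forall>bs. s = Toss bs \<longrightarrow> length bs = ctosses (run verif P x \<omega> t)))" for t
  proof (induction t)
    case 0
    have "Toss [] \<in> ctrls"
      by (simp add: ctrls_def)
    then show ?case
      by (intro conjI bexI[of _ "Toss []"]) (simp_all add: run_0 init_config_def verif_def)
  next
    case (Suc t)
    then show ?case
      using step[OF _ _ _ _ _ run_Suc[of verif P x \<omega> t]] by blast
  qed
  then show ?thesis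
    using step[OF _ _ _ _ _ run_Suc[of verif P x \<omega> t]] by blast
qed

lemma resources: "R \<in> {cons_space, cons_random_bits, oneway_input} \<Longrightarrow> R verif Ps"
proof -
  have "cons_space verif Ps"
    unfolding cons_space_def
  proof (intro exI ballI allI)
    fix P x \<omega> t
    have "(\<lambda>i. cwpos (run verif P x \<omega> i)) ` {..t} \<subseteq> {0}"
      using verif_invariant by auto
    then show "card ((\<lambda>i. cwpos (run verif P x \<omega> i)) ` {..t}) \<le> 1"
      using card_mono[of "{0::int}"] by fastforce
  qed
  moreover have "cons_random_bits verif Ps"
    unfolding cons_random_bits_def using verif_invariant by blast
  moreover have "oneway_input verif Ps"
    unfolding oneway_input_def using verif_invariant by blast
  ultimately show "R \<in> {cons_space, cons_random_bits, oneway_input} \<Longrightarrow> R verif Ps"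
    by blast
qed

section \<open>Runs of the verifier as traces of single heads\<close>

text \<open>
  All messages equal \<open>1\<close>, so the exchanges form a single sequence shared by all outcomes of the
  coin tosses, even if the prover reacts to the messages.
\<close>

primrec history :: "('a, nat) prover \<Rightarrow> 'a list \<Rightarrow> nat \<Rightarrow> (nat \<times> nat) list" where
  "history P x 0 = []"
| "history P x (Suc n) = history P x n @ [(1, P x (history P x n) 1)]"

definition cert :: "('a, nat) prover \<Rightarrow> 'a list \<Rightarrow> nat \<Rightarrow> nat" where
  "cert P x n = P x (history P x n) 1"

text \<open>The check of head \<open>j\<close> against an arbitrary sequence of announcements, freed
  from coins and provers.\<close>

primrec trace :: "(nat \<Rightarrow> nat) \<Rightarrow> 'a list \<Rightarrow> nat \<Rightarrow> nat \<Rightarrow> control \<times> nat" where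
  "trace g x j 0 = (enter j (nstart M) 0, 0)"
| "trace g x j (Suc n) = (case trace g x j n of
     (Check j' q c, i) \<Rightarrow> (case check j' q c (input_tape x i) (g n) of
        (s, mv) \<Rightarrow> (s, if mv then i + 1 else i))
   | z \<Rightarrow> z)"

lemma run_tosses:
  "t \<le> k \<Longrightarrow> cstate (run verif P x \<omega> t) = to_nat (Toss (map \<omega> [0..<t])) \<and> cipos (run verif P x \<omega> t) = 0
     \<and> ctosses (run verif P x \<omega> t) = t \<and> chist (run verif P x \<omega> t) = []"
proof (induction t)
  case 0
  show ?case by (simp add: run_0 init_config_def verif_def)
next
  case (Suc t)
  define C where "C = run verif P x \<omega> t"
  have C: "cstate C = to_nat (Toss (map \<omega> [0..<t]))" "cipos C = 0" "ctosses C = t" "chist C = []"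
    using Suc by (simp_all add: C_def)
  have "cstate C \<in> vcoin verif"
    using Suc.prems by (simp add: C verif_def)
  then have "vdelta verif (cstate C) (input_tape x (cipos C)) (cwork C (cwpos C)) (ccell C)
       (if cstate C \<in> vcoin verif then Some (\<omega> (ctosses C)) else None)
     = (to_nat (Toss (map \<omega> [0..<Suc t])), 0, 0, Stay, Stay)"
    using Suc.prems by (simp add: verif_def C delta_def)
  note vd = this
  have "\<not> (cstate C = vaccept verif \<or> cstate C = vreject verif)" "vnull verif = 0"
    by (simp_all add: C verif_def)
  then show ?case
    unfolding run_Suc C_def[symmetric] step_def Let_def vd prod.case
    using \<open>cstate C \<in> vcoin verif\<close> by (simp add: C)
qed

text \<open>Step \<open>k + 1\<close> tosses the last coin and also sends the first message, so
  reply number 0 is in the cell when checking starts.\<close>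

lemma run_first_check:
  "cstate (run verif P x \<omega> (k + 1)) = to_nat (first_check (outcome (map \<omega> [0..<k + 1]))) \<and>
   cipos (run verif P x \<omega> (k + 1)) = 0 \<and> ccell (run verif P x \<omega> (k + 1)) = cert P x 0 \<and>
   chist (run verif P x \<omega> (k + 1)) = history P x 1"
proof -
  define C where "C = run verif P x \<omega> k"
  have C: "cstate C = to_nat (Toss (map \<omega> [0..<k]))" "cipos C = 0" "ctosses C = k" "chist C = []"
    using run_tosses[of k P x \<omega>] by (simp_all add: C_def)
  have vd: "vdelta verif (cstate C) (input_tape x (cipos C)) (cwork C (cwpos C)) (ccell C)
       (if cstate C \<in> vcoin verif then Some (\<omega> (ctosses C)) else None)
     = (to_nat (first_check (outcome (map \<omega> [0..<k + 1]))), 0, 1, Stay, Stay)"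
    by (simp add: verif_def C delta_def)
  have "\<not> (cstate C = vaccept verif \<or> cstate C = vreject verif)" "vnull verif = 0"
    by (simp_all add: C verif_def)
  then show ?thesis
    unfolding Suc_eq_plus1[symmetric] run_Suc C_def[symmetric] step_def Let_def vd prod.case
    by (simp add: C cert_def)
qed

text \<open>The claims on head, cell and history are limited to \<open>Check\<close> states, because
  a halted configuration stays frozen while \<open>cert P x n\<close> and \<open>history\<close> go
  on.\<close>

lemma run_check:
  assumes p: "outcome (map \<omega> [0..<k + 1]) \<le> 2 ^ k" and j: "j = outcome (map \<omega> [0..<k + 1]) mod k"
  shows "cstate (run verif P x \<omega> (k + 1 + n)) = to_nat (fst (trace (cert P x) x j n)) \<and>
    (\<forall>q c. fst (trace (cert P x) x j n) = Check j q c \<longrightarrow>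
      cipos (run verif P x \<omega> (k + 1 + n)) = snd (trace (cert P x) x j n) \<and>
      ccell (run verif P x \<omega> (k + 1 + n)) = cert P x n \<and>
      chist (run verif P x \<omega> (k + 1 + n)) = history P x (Suc n)) \<and>
    (\<forall>bs. fst (trace (cert P x) x j n) \<noteq> Toss bs) \<and>
    (\<forall>j' q c. fst (trace (cert P x) x j n) = Check j' q c \<longrightarrow> j' = j)"
proof (induction n)
  case 0
  show ?case
    using run_first_check[of P x \<omega>] p by (simp add: first_check_def j enter_def)
next
  case (Suc n)
  define C where "C = run verif P x \<omega> (k + 1 + n)"
  obtain s i where tr: "trace (cert P x) x j n = (s, i)"
    by fastforce
  have IH: "cstate C = to_nat s" "\<And>q c. s = Check j q c \<Longrightarrow> cipos C = i \<and> ccell C = cert P x n \<and> chist C = history P x (Suc n)"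
      "\<And>bs. s \<noteq> Toss bs" "\<And>j' q c. s = Check j' q c \<Longrightarrow> j' = j"
    using Suc by (simp_all add: C_def tr)
  have run: "run verif P x \<omega> (k + 1 + Suc n) = step verif P x \<omega> C"
    by (simp add: C_def run_Suc)
  show ?case
  proof (cases s)
    case (Check j' q c)
    with IH(4) have s: "s = Check j q c" by simp
    from IH(2)[OF s] have C: "cipos C = i" "ccell C = cert P x n" "chist C = history P x (Suc n)"
      by simp_all
    obtain s' mv where ch: "check j q c (input_tape x i) (cert P x n) = (s', mv)"
      by fastforce
    have coin: "cstate C \<notin> vcoin verif"
      by (auto simp: verif_def IH(1) s)
    have vd: "vdelta verif (cstate C) (input_tape x (cipos C)) (cwork C (cwpos C)) (ccell C)
       (if cstate C \<in> vcoin verif then Some (\<omega> (ctosses C)) else None)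
      = (to_nat s', 0, 1, if mv then GoRight else Stay, Stay)"
      by (simp add: verif_def IH(1) s C delta_def ch)
    have nh: "\<not> (cstate C = vaccept verif \<or> cstate C = vreject verif)" "vnull verif = 0"
      by (simp_all add: IH(1) s verif_def)
    have D: "cstate (step verif P x \<omega> C) = to_nat s'"
        "cipos (step verif P x \<omega> C) = (if mv then i + 1 else i)"
        "ccell (step verif P x \<omega> C) = cert P x (Suc n)"
        "chist (step verif P x \<omega> C) = history P x (Suc (Suc n))"
      unfolding step_def Let_def vd prod.case using nh by (simp_all add: C cert_def)
    have tr': "trace (cert P x) x j (Suc n) = (s', if mv then i + 1 else i)"
      by (simp add: tr s ch)
    have "(\<forall>bs. s' \<noteq> Toss bs) \<and> (\<forall>j' q c. s' = Check j' q c \<longrightarrow> j' = j)"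
      using ch by (auto simp: check_def enter_def split: prod.splits if_splits)
    then show ?thesis
      unfolding run tr' fst_conv snd_conv D by blast
  next
    case Accept
    then show ?thesis
      unfolding run by (simp add: tr IH(1) step_def verif_def)
  next
    case Reject
    then show ?thesis
      unfolding run by (simp add: tr IH(1) step_def verif_def)
  qed (use IH(3) in auto)
qed

section \<open>Joint runs of all heads and soundness\<close>

inductive joint_step :: "'a list \<Rightarrow> nat \<Rightarrow> nat \<times> nat list \<times> nat \<Rightarrow> nat \<times> nat list \<times> nat \<Rightarrow> bool"
  for x g where
  "g < num_trans \<Longrightarrow> trans_of g = (q, map (input_tape x) ps, q', ms) \<Longrightarrow> count_idle ms c \<le> patience \<Longrightarrow>
   joint_step x g (q, ps, c) (q', map2 (\<lambda>p m. if m then p + 1 else p) ps ms, count_idle ms c)"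

lemma joint_step_nfa_step:
  assumes "joint_step x g (q, ps, c) (q', ps', c')"
  shows "nfa_step M x (q, ps) (q', ps')"
  using assms
proof cases
  case (1 ms)
  then show ?thesis
    using trans_of_mem[of g] by (auto simp: nfa_step_def)
qed

text \<open>The fourth claim holds since no head moves on the right end-marker. The fifth is a
  potential argument: a head movement raises the sum of the positions, which outweighs the reset of
  a counter up to \<open>patience\<close>, and every other step raises the counter.\<close>

lemma joint_step_heads:
  assumes "joint_step x g (q, ps, c) (q', ps', c')"
  shows "length ps = k" "length ps' = k" "c' \<le> patience"
    "\<And>j. j < k \<Longrightarrow> ps ! j \<le> length x + 1 \<Longrightarrow> ps' ! j \<le> length x + 1"
    "sum_list ps * (patience + 1) + c < sum_list ps' * (patience + 1) + c' \<or> c > patience"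
    "\<And>j. j < k \<Longrightarrow> \<exists>mv. check j q c (input_tape x (ps ! j)) g = (enter j q' c', mv) \<and>
       ps' ! j = (if mv then ps ! j + 1 else ps ! j)"
proof -
  obtain ms where g: "g < num_trans" "trans_of g = (q, map (input_tape x) ps, q', ms)"
      and c': "c' = count_idle ms c" "c' \<le> patience"
      and ps': "ps' = map2 (\<lambda>p m. if m then p + 1 else p) ps ms"
    using assms by cases auto
  have "(q, map (input_tape x) ps, q', ms) \<in> ntrans M"
    using trans_of_mem[OF g(1)] g(2) by simp
  note t = nfaD[OF this]
  show len: "length ps = k" "length ps' = k" "c' \<le> patience"
    using t c' by (simp_all add: ps')
  have nth: "ps' ! j = (if ms ! j then ps ! j + 1 else ps ! j)" if "j < k" for j
    using that t len by (simp add: ps')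
  show "ps' ! j \<le> length x + 1" if j: "j < k" "ps ! j \<le> length x + 1" for j
  proof (cases "ms ! j")
    case True
    then have "input_tape x (ps ! j) \<noteq> RightEnd"
      using t(5)[OF j(1)] len j by auto
    then show ?thesis
      using j by (auto simp: nth input_tape_def split: if_splits)
  qed (use j nth in auto)
  show "\<exists>mv. check j q c (input_tape x (ps ! j)) g = (enter j q' c', mv) \<and>
       ps' ! j = (if mv then ps ! j + 1 else ps ! j)" if "j < k" for j
    using that g c' len nth[OF that] by (intro exI[of _ "ms ! j"]) (simp add: check_def)
  show "sum_list ps * (patience + 1) + c < sum_list ps' * (patience + 1) + c' \<or> c > patience"
  proof (cases "c > patience")
    case False
    have mono: "(\<Sum>j<k. ps ! j) \<le> (\<Sum>j<k. ps' ! j)"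
      by (intro sum_mono) (simp add: nth)
    have sums: "sum_list ps = (\<Sum>j<k. ps ! j)" "sum_list ps' = (\<Sum>j<k. ps' ! j)"
      using len by (simp_all add: sum_list_sum_nth atLeast0LessThan)
    show ?thesis
    proof (cases "True \<in> set ms")
      case True
      then obtain j where "j < k" "ms ! j"
        using t(4) by (auto simp: in_set_conv_nth)
      then have "(\<Sum>j<k. ps ! j) < (\<Sum>j<k. ps' ! j)"
        by (intro sum_strict_mono_ex1) (auto simp: nth)
      then have "(sum_list ps + 1) * (patience + 1) \<le> sum_list ps' * (patience + 1)"
        unfolding sums by (intro mult_right_mono) auto
      then show ?thesis
        using False by (simp add: algebra_simps)
    next
      case no_move: False
      have "sum_list ps * (patience + 1) \<le> sum_list ps' * (patience + 1)"
        unfolding sums using mono by (intro mult_right_mono) auto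
      then show ?thesis
        using no_move c'(1) by (simp add: count_idle_def)
    qed
  qed simp
qed

text \<open>Each check vouches for one scanned symbol; together they make the announced transition
  applicable.\<close>

lemma joint_step_of_checks:
  assumes len: "length ps = k"
    and checks: "\<And>j. j < k \<Longrightarrow> fst (check j q c (input_tape x (ps ! j)) g) \<noteq> Reject"
  shows "\<exists>C. joint_step x g (q, ps, c) C"
proof -
  obtain q1 as q' ms where t: "trans_of g = (q1, as, q', ms)"
    by (rule prod_cases4)
  have c: "g < num_trans \<and> q1 = q \<and> as ! j = input_tape x (ps ! j) \<and> count_idle ms c \<le> patience"
    if "j < k" for j
    using checks[OF that] by (auto simp: check_def t split: if_splits)
  \<comment> \<open>\<open>k \<ge> 1\<close> provides a head that has tested the conditions common
    to all heads.\<close>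
  have c0: "g < num_trans" "q1 = q" "count_idle ms c \<le> patience"
    using c[of 0] k by auto
  have "(q1, as, q', ms) \<in> ntrans M"
    using trans_of_mem[OF c0(1)] t by simp
  then have "length as = k"
    by (rule nfaD)
  then have "as = map (input_tape x) ps"
    using c len by (intro nth_equalityI) auto
  then show ?thesis
    using joint_step.intros[of g q x ps q' ms c] c0 t by auto
qed

text \<open>If no head rejected, all traces would fit together to one run of the automaton. It would
  never meet a final state, so it would go on forever and raise the potential of
  \<open>joint_step_heads\<close> beyond every bound, although no head can pass the right
  end-marker.\<close>

lemma some_head_rejects:
  assumes x: "x \<notin> nfa_language k M"
  shows "\<exists>j<k. \<exists>n. fst (trace g x j n) = Reject"
proof (rule ccontr)
  assume no: "\<not> ?thesis"
  have "\<exists>q ps c. length ps = k \<and> (\<forall>j<k. ps ! j \<le> length x + 1) \<and> c \<le> patience \<and>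
      (nfa_step M x)\<^sup>*\<^sup>* (nstart M, replicate k 0) (q, ps) \<and>
      (\<forall>j<k. trace g x j n = (Check j q c, ps ! j)) \<and> n \<le> sum_list ps * (patience + 1) + c" for n
  proof (induction n)
    case 0
    have "nstart M \<notin> nfinal M"
      using x by (auto simp: nfa_language_def)
    then show ?case
      by (intro exI[of _ "nstart M"] exI[of _ "replicate k 0"] exI[of _ 0]) (simp add: enter_def)
  next
    case (Suc n)
    then obtain q ps c where IH: "length ps = k" "\<forall>j<k. ps ! j \<le> length x + 1" "c \<le> patience"
      "(nfa_step M x)\<^sup>*\<^sup>* (nstart M, replicate k 0) (q, ps)"
      "\<And>j. j < k \<Longrightarrow> trace g x j n = (Check j q c, ps ! j)" "n \<le> sum_list ps * (patience + 1) + c"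
      by blast
    have "fst (check j q c (input_tape x (ps ! j)) (g n)) \<noteq> Reject" if j: "j < k" for j
    proof -
      have "fst (trace g x j (Suc n)) \<noteq> Reject"
        using no j by blast
      then show ?thesis
        by (simp add: IH(5)[OF j] split: prod.splits)
    qed
    from joint_step_of_checks[OF IH(1) this] obtain q' ps' c'
      where js: "joint_step x (g n) (q, ps, c) (q', ps', c')"
      by auto
    note heads = joint_step_heads[OF js]
    have reach: "(nfa_step M x)\<^sup>*\<^sup>* (nstart M, replicate k 0) (q', ps')"
      using IH(4) joint_step_nfa_step[OF js] by (rule rtranclp.rtrancl_into_rtrancl)
    then have "q' \<notin> nfinal M"
      using x by (auto simp: nfa_language_def)
    then have "trace g x j (Suc n) = (Check j q' c', ps' ! j)" if "j < k" for j
      using heads(6)[OF that] by (auto simp: IH(5)[OF that] enter_def)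
    moreover have "Suc n \<le> sum_list ps' * (patience + 1) + c'"
      using heads(5) IH(3,6) by linarith
    ultimately show ?case
      using heads(2,3,4) IH(2) reach
      by (intro exI[of _ q'] exI[of _ ps'] exI[of _ c'] conjI allI impI) simp_all
  qed
  \<comment> \<open>One more than the potential can reach with \<open>k\<close> heads at positions
    up to \<open>length x + 1\<close> and a counter up to \<open>patience\<close>.\<close>
  from this[of "k * (length x + 1) * (patience + 1) + patience + 1"]
  obtain ps c where b: "length ps = k" "\<forall>j<k. ps ! j \<le> length x + 1" "c \<le> patience"
    "k * (length x + 1) * (patience + 1) + patience + 1 \<le> sum_list ps * (patience + 1) + c"
    by blast
  have "sum_list ps = (\<Sum>j<k. ps ! j)"
    using b(1) by (simp add: sum_list_sum_nth atLeast0LessThan)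
  also have "\<dots> \<le> (\<Sum>j<k. length x + 1)"
    using b(2) by (intro sum_mono) simp
  finally have "sum_list ps * (patience + 1) \<le> k * (length x + 1) * (patience + 1)"
    by (intro mult_right_mono) simp_all
  then show False
    using b(3,4) by linarith
qed

section \<open>Completeness: accepting runs with short idle phases\<close>

definition idle_trans :: "'a tape_symbol list \<Rightarrow> (nat \<times> nat) set" where
  "idle_trans as = {(q, q'). \<exists>ms. (q, as, q', ms) \<in> ntrans M \<and> True \<notin> set ms}"

text \<open>A path in a finite relation can be shortened to at most as many steps as the relation
  has pairs.\<close>

lemma idle_bounded:
  assumes "(q, q') \<in> (idle_trans as)\<^sup>*"
  shows "\<exists>n\<le>patience. (q, q') \<in> idle_trans as ^^ n"
proof -
  have sub: "idle_trans as \<subseteq> nstates M \<times> nstates M"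
    using nfaD by (auto simp: idle_trans_def)
  then have fin: "finite (idle_trans as)"
    using nfa_states by (auto intro: finite_subset)
  have "card (idle_trans as) \<le> patience"
    using card_mono[OF _ sub] nfa_states by (simp add: patience_def card_cartesian_product)
  moreover obtain n where "n \<le> card (idle_trans as)" "(q, q') \<in> idle_trans as ^^ n"
    using assms unfolding rtrancl_finite_eq_relpow[OF fin] by blast
  ultimately show ?thesis
    by (intro exI[of _ n] conjI) simp_all
qed

lemma map2_no_move:
  "length ps = length ms \<Longrightarrow> True \<notin> set ms \<Longrightarrow> map2 (\<lambda>p m. if m then p + 1 else p) ps ms = (ps :: nat list)"
  by (intro nth_equalityI) (auto simp: in_set_conv_nth)

lemma joint_step_of_trans:
  assumes "(q, map (input_tape x) ps, q', ms) \<in> ntrans M" "count_idle ms c \<le> patience"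
  shows "\<exists>g. joint_step x g (q, ps, c) (q', map2 (\<lambda>p m. if m then p + 1 else p) ps ms, count_idle ms c)"
proof -
  obtain g where "g < num_trans" "trans_of g = (q, map (input_tape x) ps, q', ms)"
    using trans_of assms(1) unfolding bij_betw_def by (metis imageE lessThan_iff)
  then show ?thesis
    using joint_step.intros assms(2) by blast
qed

lemma idle_run:
  assumes "(q, q') \<in> idle_trans (map (input_tape x) ps) ^^ n" "n \<le> patience"
  shows "(\<lambda>C D. \<exists>g. joint_step x g C D)\<^sup>*\<^sup>* (q, ps, 0) (q', ps, n)"
  using assms
proof (induction n arbitrary: q')
  case (Suc n)
  then obtain q1 where q1: "(q, q1) \<in> idle_trans (map (input_tape x) ps) ^^ n"
      "(q1, q') \<in> idle_trans (map (input_tape x) ps)"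
    by auto
  then obtain ms where ms: "(q1, map (input_tape x) ps, q', ms) \<in> ntrans M" "True \<notin> set ms"
    by (auto simp: idle_trans_def)
  have len: "length ps = length ms"
    using nfaD(3,4)[OF ms(1)] by simp
  have "count_idle ms n = Suc n"
    using ms(2) by (simp add: count_idle_def)
  then have "\<exists>g. joint_step x g (q1, ps, n) (q', ps, Suc n)"
    using joint_step_of_trans[OF ms(1), of n] Suc.prems map2_no_move[OF len ms(2)] by simp
  moreover have "(\<lambda>C D. \<exists>g. joint_step x g C D)\<^sup>*\<^sup>* (q, ps, 0) (q1, ps, n)"
    using Suc.IH[OF q1(1)] Suc.prems by simp
  ultimately show ?case
    by (rule rtranclp.rtrancl_into_rtrancl[rotated])
qed simp

text \<open>
  Between two head movements a shortest path uses every idle transition at most once, so it is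
  enough to allow \<open>patience\<close> idle steps in a row.
\<close>

lemma joint_reach:
  assumes "(nfa_step M x)\<^sup>*\<^sup>* (nstart M, replicate k 0) (q, ps)"
  shows "\<exists>c. (\<lambda>C D. \<exists>g. joint_step x g C D)\<^sup>*\<^sup>* (nstart M, replicate k 0, 0) (q, ps, c)"
proof -
  let ?J = "\<lambda>C D. \<exists>g. joint_step x g C D"
  \<comment> \<open>\<open>q1\<close> is a state in which the heads reach their current positions
    with counter 0. The idle steps made since then are kept as mere reachability and replaced by a
    short path when a head moves next.\<close>
  have "\<exists>q1. ?J\<^sup>*\<^sup>* (nstart M, replicate k 0, 0) (q1, snd C, 0) \<and>
      (q1, fst C) \<in> (idle_trans (map (input_tape x) (snd C)))\<^sup>*"
    if "(nfa_step M x)\<^sup>*\<^sup>* (nstart M, replicate k 0) C" for C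
    using that
  proof (induction rule: rtranclp_induct)
    case (step C D)
    then obtain q1 where q1: "?J\<^sup>*\<^sup>* (nstart M, replicate k 0, 0) (q1, snd C, 0)"
        "(q1, fst C) \<in> (idle_trans (map (input_tape x) (snd C)))\<^sup>*"
      by blast
    obtain ms where ms: "(fst C, map (input_tape x) (snd C), fst D, ms) \<in> ntrans M"
        "snd D = map2 (\<lambda>p m. if m then p + 1 else p) (snd C) ms"
      using step.hyps(2) unfolding nfa_step_def by blast
    have len: "length (snd C) = length ms"
      using nfaD(3,4)[OF ms(1)] by simp
    show ?case
    proof (cases "True \<in> set ms")
      case True
      then have c: "count_idle ms n = 0" for n
        by (simp add: count_idle_def)
      obtain n where n: "n \<le> patience" "(q1, fst C) \<in> idle_trans (map (input_tape x) (snd C)) ^^ n"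
        using idle_bounded[OF q1(2)] by blast
      have "?J\<^sup>*\<^sup>* (q1, snd C, 0) (fst C, snd C, n)"
        using idle_run[OF n(2,1)] .
      moreover have "?J (fst C, snd C, n) (fst D, snd D, 0)"
        using joint_step_of_trans[OF ms(1), of n] c ms(2) by simp
      ultimately have "?J\<^sup>*\<^sup>* (nstart M, replicate k 0, 0) (fst D, snd D, 0)"
        by (rule rtranclp.rtrancl_into_rtrancl[OF rtranclp_trans[OF q1(1)]])
      then show ?thesis by (intro exI[of _ "fst D"]) simp
    next
      case False
      then have "snd D = snd C"
        using ms(2) map2_no_move[OF len] by simp
      moreover have "(fst C, fst D) \<in> idle_trans (map (input_tape x) (snd C))"
        using ms(1) False by (auto simp: idle_trans_def)
      ultimately show ?thesis
        using q1 by (intro exI[of _ q1]) (simp add: rtrancl.rtrancl_into_rtrancl)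
    qed
  next
    case base
    show ?case by (intro exI[of _ "nstart M"]) simp
  qed
  from this[OF assms] obtain q1 where q1: "?J\<^sup>*\<^sup>* (nstart M, replicate k 0, 0) (q1, ps, 0)"
      "(q1, q) \<in> (idle_trans (map (input_tape x) ps))\<^sup>*"
    by auto
  obtain n where n: "n \<le> patience" "(q1, q) \<in> idle_trans (map (input_tape x) ps) ^^ n"
    using idle_bounded[OF q1(2)] by blast
  show ?thesis
    using rtranclp_trans[OF q1(1) idle_run[OF n(2,1)]] by (rule exI)
qed

text \<open>The certificate lists the numbers of the transitions along a run given by
  \<open>joint_reach\<close>, padded with zeros.\<close>

lemma certificate_exists:
  assumes "x \<in> nfa_language k M"
  shows "\<exists>g. (\<forall>n. g n \<le> num_trans) \<and> (\<forall>j<k. \<exists>n. fst (trace g x j n) = Accept)"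
proof -
  let ?J = "\<lambda>C D. \<exists>g. joint_step x g C D"
  obtain q ps where q: "(nfa_step M x)\<^sup>*\<^sup>* (nstart M, replicate k 0) (q, ps)" "q \<in> nfinal M"
    using assms by (auto simp: nfa_language_def)
  obtain c where "?J\<^sup>*\<^sup>* (nstart M, replicate k 0, 0) (q, ps, c)"
    using joint_reach[OF q(1)] by blast
  then obtain m where "(?J ^^ m) (nstart M, replicate k 0, 0) (q, ps, c)"
    by (metis rtranclp_imp_relpowp)
  then obtain C where C: "C 0 = (nstart M, replicate k 0, 0)" "C m = (q, ps, c)"
      "\<And>n. n < m \<Longrightarrow> ?J (C n) (C (Suc n))"
    unfolding relpowp_fun_conv by auto
  define g where "g n = (if n < m then SOME g. joint_step x g (C n) (C (Suc n)) else 0)" for n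
  have g: "joint_step x (g n) (C n) (C (Suc n))" if "n < m" for n
    using someI_ex[OF C(3)[OF that]] that by (simp add: g_def)
  have bound: "g n \<le> num_trans" for n
  proof (cases "n < m")
    case True
    from g[OF True] show ?thesis by cases simp
  qed (simp add: g_def)
  \<comment> \<open>The first alternative covers a final state met before the end of the run, where
    the check stops early.\<close>
  have "fst (trace g x j n) = Accept \<or>
      trace g x j n = (enter j (fst (C n)) (snd (snd (C n))), fst (snd (C n)) ! j)"
    if j: "j < k" and "n \<le> m" for j n
    using \<open>n \<le> m\<close>
  proof (induction n)
    case 0
    then show ?case using j by (simp add: C)
  next
    case (Suc n)
    obtain q1 ps1 c1 where C1: "C n = (q1, ps1, c1)"
      by (metis surj_pair)
    obtain q2 ps2 c2 where C2: "C (Suc n) = (q2, ps2, c2)"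
      by (metis surj_pair)
    have "joint_step x (g n) (q1, ps1, c1) (q2, ps2, c2)"
      using g[of n] Suc.prems by (simp add: C1 C2)
    from joint_step_heads(6)[OF this j] obtain mv where
      mv: "check j q1 c1 (input_tape x (ps1 ! j)) (g n) = (enter j q2 c2, mv)"
        "ps2 ! j = (if mv then ps1 ! j + 1 else ps1 ! j)"
      by blast
    obtain s i where tr: "trace g x j n = (s, i)"
      by fastforce
    show ?case
    proof (cases "s = Accept")
      case True
      then show ?thesis by (simp add: tr)
    next
      case False
      then have "s = Check j q1 c1" "i = ps1 ! j"
        using Suc.IH Suc.prems by (auto simp: tr C1 enter_def split: if_splits)
      then show ?thesis
        using mv by (simp add: tr C2)
    qed
  qed
  from this[OF _ order_refl] have "fst (trace g x j m) = Accept" if "j < k" for j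
    using q(2) that by (fastforce simp: C enter_def)
  then show ?thesis
    using bound by blast
qed

section \<open>Counting accepting and rejecting outcomes\<close>

lemma two_k_le: "2 * k \<le> 2 ^ k"
proof -
  have "k - 1 < 2 ^ (k - 1)" by (rule less_exp)
  then have "k \<le> 2 ^ (k - 1)" using k by linarith
  then have "2 * k \<le> 2 * 2 ^ (k - 1)" by simp
  also have "\<dots> = 2 ^ k"
    using k by (cases k) auto
  finally show ?thesis .
qed

lemma run_coins:
  assumes p: "p < 2 ^ (k + 1)"
  shows "p \<le> 2 ^ k \<Longrightarrow> cstate (run verif P x ((!) (coins (k + 1) p)) (k + 1 + n))
       = to_nat (fst (trace (cert P x) x (p mod k) n))"
    and "\<not> p \<le> 2 ^ k \<Longrightarrow> cstate (run verif P x ((!) (coins (k + 1) p)) (k + 1)) = to_nat Reject"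
proof -
  have "map ((!) (coins (k + 1) p)) [0..<k + 1] = coins (k + 1) p"
    using map_nth[of "coins (k + 1) p"] length_coins[OF p] by simp
  then have o: "outcome (map ((!) (coins (k + 1) p)) [0..<k + 1]) = p"
    by (simp only: outcome_coins[OF p])
  show "cstate (run verif P x ((!) (coins (k + 1) p)) (k + 1 + n))
       = to_nat (fst (trace (cert P x) x (p mod k) n))" if "p \<le> 2 ^ k"
    using run_check[of "(!) (coins (k + 1) p)" "p mod k" P x n] that unfolding o by blast
  show "cstate (run verif P x ((!) (coins (k + 1) p)) (k + 1)) = to_nat Reject" if "\<not> p \<le> 2 ^ k"
    using run_first_check[of P x "(!) (coins (k + 1) p)"] that unfolding o by (simp add: first_check_def)
qed

text \<open>Chosen so that \<open>1 - error\<close> is the proportion of \<open>2 ^ k + 1\<close>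
  among \<open>2 ^ (k + 1)\<close> outcomes.\<close>

definition error :: real where
  "error = 1 / 2 - 1 / 2 ^ (k + 1)"

lemma error_bound:
  assumes "2 ^ k + 1 \<le> n"
  shows "1 - error \<le> real n / 2 ^ (k + 1)"
proof -
  have "real (2 ^ k + 1) \<le> real n"
    using assms by (simp only: of_nat_le_iff)
  then have "(2 ^ k + 1) / 2 ^ (k + 1) \<le> real n / 2 ^ (k + 1)"
    by (intro divide_right_mono) simp_all
  then show ?thesis
    by (simp add: error_def field_simps)
qed

lemma tosses_bound: "ctosses (run verif P x \<omega> t) \<le> k + 1"
  using verif_invariant by blast

lemma accept_prob_verif:
  assumes "\<And>j. j < k \<Longrightarrow> \<exists>n. fst (trace (cert P x) x j n) = Accept"
  shows "1 - error \<le> accept_prob verif P x"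
proof -
  let ?A = "{p. p < 2 ^ (k + 1) \<and> (\<exists>t. cstate (run verif P x ((!) (coins (k + 1) p)) t) = vaccept verif)}"
  have "{..2 ^ k} \<subseteq> ?A"
  proof
    fix p :: nat assume p: "p \<in> {..2 ^ k}"
    have "(2::nat) ^ k < 2 ^ (k + 1)" by simp
    then have lt: "p < 2 ^ (k + 1)" using p by (meson atMost_iff le_less_trans)
    obtain n where "fst (trace (cert P x) x (p mod k) n) = Accept"
      using assms[of "p mod k"] k by auto
    then have "cstate (run verif P x ((!) (coins (k + 1) p)) (k + 1 + n)) = vaccept verif"
      using run_coins(1)[OF lt, of P x n] p by (simp add: verif_def)
    then show "p \<in> ?A" using lt by blast
  qed
  then have "card {..2 ^ k :: nat} \<le> card ?A"
    by (intro card_mono) auto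
  then show ?thesis
    unfolding accept_prob_def measure_run_state[OF tosses_bound] by (intro error_bound) simp
qed

text \<open>
  The outcomes \<open>j\<close> and \<open>j + k\<close> both check head \<open>j\<close>, which tips the balance in favour of rejection.
\<close>

lemma reject_prob_verif:
  assumes j: "j < k" "fst (trace (cert P x) x j n) = Reject"
  shows "1 - error \<le> reject_prob verif P x"
proof -
  let ?A = "{p. p < 2 ^ (k + 1) \<and> (\<exists>t. cstate (run verif P x ((!) (coins (k + 1) p)) t) = vreject verif)}"
  \<comment> \<open>The \<open>2 ^ k - 1\<close> outcomes that reject at once, and two that check
    head \<open>j\<close>.\<close>
  let ?B = "{2 ^ k<..<2 ^ (k + 1)} \<union> {j, j + k}"
  have lt: "(2::nat) ^ k < 2 ^ (k + 1)" by simp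
  have jk: "j + k < 2 ^ k"
    using j(1) two_k_le by linarith
  have "?B \<subseteq> ?A"
  proof
    fix p assume "p \<in> ?B"
    then consider "2 ^ k < p" "p < 2 ^ (k + 1)" | "p = j \<or> p = j + k" by auto
    then show "p \<in> ?A"
    proof cases
      case 1
      then have "cstate (run verif P x ((!) (coins (k + 1) p)) (k + 1)) = vreject verif"
        using run_coins(2)[of p P x] by (simp add: verif_def)
      then show ?thesis using 1 by blast
    next
      case 2
      then have p: "p \<le> 2 ^ k" "p mod k = j"
        using jk j(1) by auto
      from p(1) lt have p2: "p < 2 ^ (k + 1)" by (rule le_less_trans)
      then have "cstate (run verif P x ((!) (coins (k + 1) p)) (k + 1 + n)) = vreject verif"
        using run_coins(1)[OF p2 p(1), of P x n] j(2) p(2) by (simp add: verif_def)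
      then show ?thesis using p2 by blast
    qed
  qed
  then have "card ?B \<le> card ?A"
    by (intro card_mono) auto
  moreover have "card ?B = card {2 ^ k<..<2 ^ (k + 1) :: nat} + card {j, j + k}"
    using jk by (intro card_Un_disjoint) auto
  moreover have "card {j, j + k} = 2"
    using k by simp
  moreover have "card {2 ^ k<..<2 ^ (k + 1) :: nat} = 2 ^ k - 1"
    by simp
  moreover have "1 \<le> (2::nat) ^ k" by simp
  ultimately have "2 ^ k + 1 \<le> card ?A"
    by linarith
  then show ?thesis
    unfolding reject_prob_def measure_run_state[OF tosses_bound] by (rule error_bound)
qed

lemma length_history: "length (history P x n) = n"
  by (induction n) auto

text \<open>Completeness supplies a certificate, that is, a one-way prover, and soundness holds
  against every prover; so both communication models are covered at once.\<close>

lemma proof_system_verif: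
  assumes Ps: "oneway_provers verif \<subseteq> Ps"
  shows "proof_system verif Ps error (nfa_language k M)"
proof -
  \<comment> \<open>Outside the language any certificate will do; zeros keep \<open>P\<close> inside
    the communication alphabet.\<close>
  define c where "c x = (if x \<in> nfa_language k M
      then SOME g. (\<forall>n. g n \<le> num_trans) \<and> (\<forall>j<k. \<exists>n. fst (trace g x j n) = Accept) else (\<lambda>_. 0))" for x
  have c: "(\<forall>n. c x n \<le> num_trans) \<and> (\<forall>j<k. \<exists>n. fst (trace (c x) x j n) = Accept)"
    if "x \<in> nfa_language k M" for x
    using someI_ex[OF certificate_exists[OF that]] that by (simp add: c_def)
  define P :: "('a, nat) prover" where "P x h m = c x (length h)" for x h m
  have "c x n \<le> num_trans" for x n
  proof (cases "x \<in> nfa_language k M")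
    case False
    then show ?thesis by (simp add: c_def)
  qed (use c in blast)
  then have "P \<in> provers verif"
    by (simp add: provers_def P_def verif_def le_SucI)
  then have "P \<in> oneway_provers verif"
    by (auto simp: oneway_provers_def P_def)
  moreover have "1 - error \<le> accept_prob verif P x" if "x \<in> nfa_language k M" for x
  proof (rule accept_prob_verif)
    have "cert P x = c x"
      by (simp add: cert_def P_def length_history fun_eq_iff)
    then show "\<exists>n. fst (trace (cert P x) x j n) = Accept" if "j < k" for j
      using c[OF \<open>x \<in> nfa_language k M\<close>] that by simp
  qed
  moreover have "1 - error \<le> reject_prob verif P x" if "x \<notin> nfa_language k M" for x P
    using some_head_rejects[OF that] reject_prob_verif by blast
  ultimately show ?thesis
    using Ps unfolding proof_system_def by blast
qed

end

lemma oneNFA_in_IP: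
  fixes L :: "'a::finite list set"
  assumes L: "L \<in> oneNFA k" and k: "k \<ge> 1"
  shows "L \<in> IP {cons_space, cons_random_bits, oneway_input}"
    and "L \<in> oneway_IP {cons_space, cons_random_bits, oneway_input}"
proof -
  obtain M :: "('a, nat) multihead_nfa" where M: "is_oneway_nfa k M" "L = nfa_language k M"
    using L by (auto simp: oneNFA_def)
  interpret head_checker k M
    using M(1) k by unfold_locales
  have err: "error < 1 / 2"
    by (simp add: error_def)
  have res: "\<forall>R\<in>{cons_space, cons_random_bits, oneway_input}. R verif Ps" for Ps
    using resources by (intro ballI)
  have sub: "oneway_provers verif \<subseteq> provers verif"
    by (auto simp: oneway_provers_def)
  show "L \<in> IP {cons_space, cons_random_bits, oneway_input}"
    unfolding IP_def mem_Collect_eq M(2)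
    by (intro exI conjI) (rule is_verifier_verif err res proof_system_verif[OF sub])+
  show "L \<in> oneway_IP {cons_space, cons_random_bits, oneway_input}"
    unfolding oneway_IP_def mem_Collect_eq M(2)
    by (intro exI conjI) (rule is_verifier_verif err res proof_system_verif[OF order_refl])+
qed

theorem theorem4:
  shows "(oneway_IP {cons_space, cons_random_bits, oneway_input} :: 'a::finite list set set)
           = IP {cons_space, cons_random_bits, oneway_input} \<and>
         (IP {cons_space, cons_random_bits, oneway_input} :: 'a list set set)
           = (\<Union>k\<in>{1..}. oneNFA k)"
proof -
  let ?Rs = "{cons_space, cons_random_bits, oneway_input} :: 'a restriction set"
  have "IP ?Rs \<subseteq> (\<Union>k\<in>{1..}. oneNFA k)"
  proof
    fix L assume "L \<in> IP ?Rs"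
    then obtain V \<epsilon> where "is_verifier V" "\<epsilon> < 1 / 2" "\<forall>R\<in>?Rs. R V (provers V)"
        "proof_system V (provers V) \<epsilon> L"
      unfolding IP_def mem_Collect_eq by (elim exE conjE)
    then show "L \<in> (\<Union>k\<in>{1..}. oneNFA k)"
      by (intro proof_system_in_Union_oneNFA[of V \<epsilon>]) simp_all
  qed
  moreover have "oneway_IP ?Rs \<subseteq> (\<Union>k\<in>{1..}. oneNFA k)"
  proof
    fix L assume "L \<in> oneway_IP ?Rs"
    then obtain V \<epsilon> where "is_verifier V" "\<epsilon> < 1 / 2" "\<forall>R\<in>?Rs. R V (oneway_provers V)"
        "proof_system V (oneway_provers V) \<epsilon> L"
      unfolding oneway_IP_def mem_Collect_eq by (elim exE conjE)
    then show "L \<in> (\<Union>k\<in>{1..}. oneNFA k)"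
      by (intro proof_system_in_Union_oneNFA[of V \<epsilon>]) simp_all
  qed
  moreover have "(\<Union>k\<in>{1..}. oneNFA k) \<subseteq> IP ?Rs" "(\<Union>k\<in>{1..}. oneNFA k) \<subseteq> oneway_IP ?Rs"
    using oneNFA_in_IP by auto
  ultimately show ?thesis
    by (intro conjI) (metis subset_antisym)+
qed

end
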